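(* Let $T$ be the tree with vertex set $\{1,2,\ldots,9\}$ and edges $\{1,2\},\{2,3\},\{3,4\},\{2,5\},\{1,6\},\{1,7\},\{7,8\},\{8,9\}$. Then $T$ is the smallest asymmetric tree that is not a subdivided star: $T$ is asymmetric, $T$ is not a subdivided star, and every asymmetric tree with at least two vertices that is not a subdivided star and is not isomorphic to $T$ has more than $9$ vertices.
   Context: All graphs are finite, undirected, without loops or multiple edges. A graph is asymmetric if its automorphism group (acting on vertices) is trivial. Subdividing an edge $uv$ means replacing it by two edges $uw$ and $wv$, where $w$ is a new vertex. A subdivided star is a graph that can be obtained from a star $K_{1,m}$ (for some $m \ge 1$) by performing one or more edge subdivisions (edges may be subdivided repeatedly). *)

theory Defs
  imports
    "Graph_Theory.Digraph_Isomorphism"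
    "Graph_Theory.Kuratowski"
begin

text \<open>
  A finite simple undirected graph is a \<^term>\<open>pair_graph\<close>: a finite vertex set with an irreflexive
  symmetric arc relation, each undirected edge being represented by its two opposite arcs.
\<close>

text \<open>
  The constant \<^const>\<open>tree\<close> of the library is not usable here: its \<^const>\<open>forest\<close> already counts
  the closed walk u, v, u along a single undirected edge as a cycle. In a \<^term>\<open>pair_graph\<close> the
  cycles of length at least 3 are exactly the cycles of the undirected graph.
\<close>
definition undirected_tree :: "'a pair_pre_digraph \<Rightarrow> bool" where
  "undirected_tree G \<longleftrightarrow>
     pair_graph G \<and> Digraph_Component.connected (with_proj G) \<and>
     \<not> (\<exists>p. pre_digraph.cycle (with_proj G) p \<and> length p \<ge> 3)"

definition asymmetric_graph :: "'a pair_pre_digraph \<Rightarrow> bool" where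
  "asymmetric_graph G \<longleftrightarrow>
     (\<forall>f. pre_digraph.digraph_isomorphism (with_proj G) f \<and> app_iso f (with_proj G) = with_proj G
        \<longrightarrow> (\<forall>v\<in>pverts G. iso_verts f v = v))"

definition edge_subdivision :: "'a pair_pre_digraph \<Rightarrow> 'a pair_pre_digraph \<Rightarrow> bool" where
  "edge_subdivision G H \<longleftrightarrow>
     (\<exists>u v w. (u, v) \<in> parcs G \<and> w \<notin> pverts G \<and> H = subdivide G (u, v) w)"

text \<open>
  The star may be taken on the vertex type of \<open>G\<close>, since subdividing only adds vertices. The
  transitive, not reflexive, closure expresses that at least one subdivision is performed.
\<close>
definition subdivided_star :: "'a pair_pre_digraph \<Rightarrow> bool" where
  "subdivided_star G \<longleftrightarrow>
     (\<exists>S m. m \<ge> 1 \<and> complete_bipartite_digraph 1 m (with_proj S) \<and> edge_subdivision\<^sup>+\<^sup>+ S G)"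

definition T9 :: "nat pair_pre_digraph" where
  "T9 = (let E = {(1,2), (2,3), (3,4), (2,5), (1,6), (1,7), (7,8), (8,9)}
         in \<lparr> pverts = {1..9}, parcs = E \<union> E\<inverse> \<rparr>)"

end

theory Submission
  imports Defs
begin

text \<open>
  Root an asymmetric tree at any vertex. If every branch there is a pendant path (a leg), then the tree
  is a spider, hence a subdivided star. Otherwise, descending into branches that are not legs
  yields two vertices \<open>u\<close> and \<open>v\<close> of degree at least 3, all of whose branches, except the one
  towards the other vertex, are legs. By asymmetry the legs at one vertex have distinct
  lengths, so each of \<open>u\<close> and \<open>v\<close> carries at least 1 + 2 leg vertices. With at most 9 vertices the
  leg lengths are 1, 2 at both, in which case exchanging the two ends is an automorphism, or
  1, 2 and 1, 3, in which case no vertex is left over and the tree is \<open>T9\<close>.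
\<close>

section \<open>Trees as symmetric relations\<close>

text \<open>Deleting the vertex \<open>x\<close> splits a tree into components, and
  \<open>branch E x y\<close> is the component of \<open>y\<close>. Acyclicity of an arbitrary tree
  enters only as the statement that distinct neighbours of a vertex have different branches, so
  legs, forks and counts never mention cycles. Asymmetry is contradicted only by involutions, which
  are their own inverses. The number 9 is 2 + 3 + 4: two branching vertices with leg vertices 1 + 2
  and 1 + 3, because two ends of size 1 + 2 are interchangeable. Two obstacles shape the details.
  The vertices \<open>u\<close> and \<open>v\<close> are not known to be adjacent: with legs 1, 2 at
  both, a ninth vertex may lie between them, and the exchange has to fix it. And
  \<open>subdivided_star\<close> demands at least one subdivision, so a spider that is a bare star
  has to be excluded, which is again done by asymmetry.\<close>

definition branch :: "'a rel \<Rightarrow> 'a \<Rightarrow> 'a \<Rightarrow> 'a set" where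
  "branch E x y = {z. (y, z) \<in> (E \<inter> (- {x}) \<times> (- {x}))\<^sup>*}"

lemma branch_self: "y \<in> branch E x y"
  by (simp add: branch_def)

lemma branch_induct [consumes 1, case_names base step]:
  assumes "z \<in> branch E x y" "P y"
    and "\<And>z w. z \<in> branch E x y \<Longrightarrow> P z \<Longrightarrow> (z, w) \<in> E \<Longrightarrow> z \<noteq> x \<Longrightarrow> w \<noteq> x \<Longrightarrow> P w"
  shows "P z"
proof -
  have "(y, z) \<in> (E \<inter> (- {x}) \<times> (- {x}))\<^sup>*" using assms(1) by (simp add: branch_def)
  then show ?thesis
    by (induction rule: rtrancl_induct) (use assms(2,3) in \<open>auto simp: branch_def\<close>)
qed

text \<open>Distinctness matters here: by reflexivity of the closure, \<open>branch E x x\<close> is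
  \<open>{x}\<close>.\<close>

lemma notin_branch: "x \<noteq> y \<Longrightarrow> x \<notin> branch E x y"
proof
  assume "x \<noteq> y"
  have "z \<noteq> x" if "z \<in> branch E x y" for z
    using that \<open>x \<noteq> y\<close> by (induction rule: branch_induct) auto
  moreover assume "x \<in> branch E x y"
  ultimately show False by blast
qed

lemma branch_step:
  assumes "z \<in> branch E x y" "(z, w) \<in> E" "x \<noteq> y" "w \<noteq> x"
  shows "w \<in> branch E x y"
proof -
  have "z \<noteq> x" using assms(1,3) notin_branch by metis
  with assms show ?thesis unfolding branch_def by (auto intro: rtrancl_into_rtrancl)
qed

text \<open>A walk from \<open>w\<close> that avoids \<open>v\<close> stays in
  \<open>branch E v w\<close> and so never meets \<open>x\<close>; hence it is also a walk avoiding
  \<open>x\<close>, and it starts inside \<open>branch E x y\<close>.\<close>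

lemma branch_subset:
  assumes "w \<in> branch E x y" "x \<noteq> y" "x \<notin> branch E v w" "v \<noteq> w"
  shows "branch E v w \<subseteq> branch E x y"
proof
  fix z assume "z \<in> branch E v w"
  then have "z \<in> branch E v w \<and> z \<in> branch E x y"
  proof (induction rule: branch_induct)
    case base
    show ?case using assms(1) by (simp add: branch_self)
  next
    case (step a b)
    then have "b \<in> branch E v w" using assms(4) branch_step by metis
    moreover from this have "b \<noteq> x" using assms(3) by auto
    ultimately show ?case using step assms(2) branch_step by metis
  qed
  then show "z \<in> branch E x y" ..
qed

section \<open>Asymmetry of a relation, and swaps of vertex lists\<close>

text \<open>Asymmetry in terms of the vertex map alone; \<open>asymmetric_graph_iff_rigid\<close>
  translates. The map is total on the type, but only its values on \<open>V\<close> are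
  constrained.\<close>

definition rigid :: "'a set \<Rightarrow> 'a rel \<Rightarrow> bool" where
  "rigid V E \<longleftrightarrow> (\<forall>f. bij_betw f V V \<and> map_prod f f ` E = E \<longrightarrow> (\<forall>v\<in>V. f v = v))"

text \<open>Being its own inverse on \<open>V\<close>, the map is a bijection, and every arc is the
  image of its own image; so preservation of arcs in one direction is all that has to be
  checked.\<close>

lemma rigid_involution:
  assumes "rigid V E" "\<And>v. v \<in> V \<Longrightarrow> f v \<in> V" "\<And>v. v \<in> V \<Longrightarrow> f (f v) = v"
    and "E \<subseteq> V \<times> V" "\<And>a b. (a, b) \<in> E \<Longrightarrow> (f a, f b) \<in> E" "v \<in> V"
  shows "f v = v"
proof -
  have "bij_betw f V V"
    using assms(2,3) by (intro bij_betw_byWitness[where f' = f]) auto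
  moreover have "map_prod f f ` E = E"
  proof
    show "map_prod f f ` E \<subseteq> E" using assms(5) by auto
    show "E \<subseteq> map_prod f f ` E"
    proof
      fix e assume e: "e \<in> E"
      obtain a b where ab: "e = (a, b)" by (cases e)
      have "map_prod f f (f a, f b) = e" using ab e assms(3,4) by auto
      moreover have "(f a, f b) \<in> E" using ab e assms(5) by auto
      ultimately show "e \<in> map_prod f f ` E" by (metis image_eqI)
    qed
  qed
  ultimately show ?thesis using assms(1,6) unfolding rigid_def by blast
qed

text \<open>For disjoint distinct lists of equal length this is the involution exchanging entries at
  equal positions and fixing all else.\<close>

definition swap_lists :: "'a list \<Rightarrow> 'a list \<Rightarrow> 'a \<Rightarrow> 'a" where
  "swap_lists xs ys v =
     (case (map_of (zip ys xs) ++ map_of (zip xs ys)) v of None \<Rightarrow> v | Some w \<Rightarrow> w)"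

lemma
  assumes "distinct (xs @ ys)" "length xs = length ys"
  shows swap_lists_nth_left: "i < length xs \<Longrightarrow> swap_lists xs ys (xs ! i) = ys ! i"
    and swap_lists_nth_right: "i < length xs \<Longrightarrow> swap_lists xs ys (ys ! i) = xs ! i"
    and swap_lists_other: "v \<notin> set xs \<Longrightarrow> v \<notin> set ys \<Longrightarrow> swap_lists xs ys v = v"
proof -
  { assume i: "i < length xs"
    then have "ys ! i \<in> set ys" using assms(2) by simp
    \<comment> \<open>In \<open>++\<close> the right map takes precedence, so the left map decides
      at \<open>ys ! i\<close> only because distinctness keeps that vertex out of
      \<open>xs\<close>.\<close>
    then have none: "map_of (zip xs ys) (ys ! i) = None"
      using assms by (subst map_of_zip_is_None) auto
    have "map_of (zip ys xs) (ys ! i) = Some (xs ! i)"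
      using assms i by (simp add: map_of_zip_nth)
    then show "swap_lists xs ys (ys ! i) = xs ! i"
      by (simp only: swap_lists_def map_add_def none option.case)
    show "swap_lists xs ys (xs ! i) = ys ! i"
      using assms i by (simp add: swap_lists_def map_add_def map_of_zip_nth)
  }
  assume v: "v \<notin> set xs" "v \<notin> set ys"
  have "map_of (zip ys xs) v = None" "map_of (zip xs ys) v = None"
    using v assms by (simp_all add: map_of_zip_is_None)
  then show "swap_lists xs ys v = v"
    by (simp add: swap_lists_def map_add_def)
qed

text \<open>The check is local: arcs ending at a listed vertex follow from those starting there by
  symmetry, and arcs with no listed end are fixed. The resulting automorphism moves
  \<open>xs ! 0\<close> to the different vertex \<open>ys ! 0\<close>.\<close>

lemma rigid_no_swap:
  assumes "rigid V E" "E \<subseteq> V \<times> V" "sym E"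
    and "distinct (xs @ ys)" "length xs = length ys" "xs \<noteq> []" "set xs \<union> set ys \<subseteq> V"
    and left: "\<And>i. i < length xs \<Longrightarrow> swap_lists xs ys ` (E `` {xs ! i}) \<subseteq> E `` {ys ! i}"
    and right: "\<And>i. i < length xs \<Longrightarrow> swap_lists xs ys ` (E `` {ys ! i}) \<subseteq> E `` {xs ! i}"
  shows False
proof -
  let ?f = "swap_lists xs ys"
  note sw = swap_lists_nth_left[OF assms(4,5)] swap_lists_nth_right[OF assms(4,5)]
    swap_lists_other[OF assms(4,5)]
  have cases: "(\<exists>i<length xs. v = xs ! i) \<or> (\<exists>i<length xs. v = ys ! i) \<or> (v \<notin> set xs \<and> v \<notin> set ys)" for v
    using assms(5) by (metis in_set_conv_nth)
  have arc: "(?f a, ?f b) \<in> E" if "(a, b) \<in> E" "a \<in> set xs \<union> set ys" for a b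
    using cases[of a]
  proof (elim disjE exE conjE)
    fix i assume "i < length xs" "a = xs ! i"
    then show ?thesis using left[of i] that(1) sw(1)[of i] by auto
  next
    fix i assume "i < length xs" "a = ys ! i"
    then show ?thesis using right[of i] that(1) sw(2)[of i] by auto
  qed (use that in auto)
  have "?f (xs ! 0) = xs ! 0"
  proof (rule rigid_involution[OF assms(1)])
    fix v assume v: "v \<in> V"
    have "?f v \<in> V \<and> ?f (?f v) = v"
      using cases[of v] v assms(5,7) by (elim disjE exE conjE) (auto simp: sw)
    then show "?f v \<in> V" "?f (?f v) = v" by auto
  next
    fix a b assume ab: "(a, b) \<in> E"
    consider "a \<in> set xs \<union> set ys" | "b \<in> set xs \<union> set ys"
      | "a \<notin> set xs \<union> set ys" "b \<notin> set xs \<union> set ys" by blast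
    then show "(?f a, ?f b) \<in> E"
    proof cases
      case 1 then show ?thesis using arc ab by blast
    next
      case 2 then show ?thesis using arc ab \<open>sym E\<close> by (meson symD)
    next
      case 3 then show ?thesis using ab sw(3) by auto
    qed
  next
    show "xs ! 0 \<in> V" using assms(6,7) by auto
  qed (use assms in auto)
  moreover have "?f (xs ! 0) = ys ! 0" using sw(1)[of 0] assms(6) by simp
  moreover have "xs ! 0 \<in> set xs" "ys ! 0 \<in> set ys"
    using assms(5,6) by (metis length_greater_0_conv nth_mem)+
  ultimately show False using assms(4) by auto
qed

section \<open>Trees described by their branches\<close>

text \<open>\<open>branch_separates\<close> stands for acyclicity: after deletion of
  \<open>x\<close> its neighbours are pairwise disconnected. \<open>undirected_tree_rel\<close>
  derives it from the absence of long cycles.\<close>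

locale tree_rel =
  fixes V :: "'a set" and E :: "'a rel"
  assumes finite_V: "finite V"
    and arcs_V: "E \<subseteq> V \<times> V"
    and sym_E: "sym E"
    and irrefl_E: "(x, x) \<notin> E"
    and connected_E: "x \<in> V \<Longrightarrow> y \<in> V \<Longrightarrow> (x, y) \<in> E\<^sup>*"
    and branch_separates: "(x, y) \<in> E \<Longrightarrow> (x, z) \<in> E \<Longrightarrow> y \<noteq> z \<Longrightarrow> z \<notin> branch E x y"
begin

lemma arc_sym: "(x, y) \<in> E \<Longrightarrow> (y, x) \<in> E"
  using sym_E by (rule symD)

lemma arc_neq: "(x, y) \<in> E \<Longrightarrow> x \<noteq> y"
  using irrefl_E by auto

lemma arc_V: "(x, y) \<in> E \<Longrightarrow> x \<in> V" "(x, y) \<in> E \<Longrightarrow> y \<in> V"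
  using arcs_V by auto

lemma branch_V: "y \<in> V \<Longrightarrow> branch E x y \<subseteq> V"
proof
  fix z assume "z \<in> branch E x y" "y \<in> V"
  then show "z \<in> V" by (induction rule: branch_induct) (auto simp: arc_V)
qed

text \<open>A common vertex joins \<open>y\<close> to \<open>z\<close> outside \<open>x\<close>, one
  of the two walks being reversed by symmetry of the restricted relation.\<close>

lemma branch_disjoint:
  assumes "(x, y) \<in> E" "(x, z) \<in> E" "y \<noteq> z"
  shows "branch E x y \<inter> branch E x z = {}"
proof (rule ccontr)
  let ?R = "E \<inter> (- {x}) \<times> (- {x})"
  assume "branch E x y \<inter> branch E x z \<noteq> {}"
  then obtain w where "(y, w) \<in> ?R\<^sup>*" "(z, w) \<in> ?R\<^sup>*" by (auto simp: branch_def)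
  moreover have "sym ?R" using sym_E by (auto simp: sym_def)
  ultimately have "(y, z) \<in> ?R\<^sup>*" by (meson rtrancl_trans sym_rtrancl symD)
  then show False using branch_separates[OF assms] by (simp add: branch_def)
qed

text \<open>Seen from \<open>y\<close>, the vertices \<open>x\<close> and \<open>z\<close> are
  distinct neighbours, so the branch through \<open>z\<close> cannot get back to
  \<open>x\<close>.\<close>

lemma branch_child_subset:
  assumes "(x, y) \<in> E" "(y, z) \<in> E" "z \<noteq> x"
  shows "branch E y z \<subseteq> branch E x y"
proof (rule branch_subset)
  show "z \<in> branch E x y" using branch_step[OF branch_self] assms arc_neq by metis
  show "x \<notin> branch E y z" using branch_separates[of y z x] assms arc_sym by auto
qed (use assms arc_neq in auto)

lemma branch_decomp:
  assumes "(x, y) \<in> E"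
  shows "branch E x y = insert y (\<Union>z\<in>E `` {y} - {x}. branch E y z)"
proof
  show "insert y (\<Union>z\<in>E `` {y} - {x}. branch E y z) \<subseteq> branch E x y"
    using branch_child_subset[OF assms] branch_self by fastforce
  show "branch E x y \<subseteq> insert y (\<Union>z\<in>E `` {y} - {x}. branch E y z)"
  proof
    fix a assume "a \<in> branch E x y"
    then show "a \<in> insert y (\<Union>z\<in>E `` {y} - {x}. branch E y z)"
    proof (induction rule: branch_induct)
      case (step a b)
      show ?case
      proof (cases "a = y \<or> b = y")
        case True
        then show ?thesis using step branch_self by fastforce
      next
        case False
        then obtain z where z: "z \<in> E `` {y} - {x}" "a \<in> branch E y z" using step by auto
        then have "y \<noteq> z" using arc_neq by auto
        with z False step branch_step have "b \<in> branch E y z" by metis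
        then show ?thesis using z by auto
      qed
    qed simp
  qed
qed

lemma vertices_decomp:
  assumes "u \<in> V"
  shows "V = insert u (\<Union>w\<in>E `` {u}. branch E u w)"
proof
  show "insert u (\<Union>w\<in>E `` {u}. branch E u w) \<subseteq> V"
    using branch_V assms arc_V by blast
  show "V \<subseteq> insert u (\<Union>w\<in>E `` {u}. branch E u w)"
  proof
    fix a assume "a \<in> V"
    with assms have "(u, a) \<in> E\<^sup>*" by (rule connected_E)
    then show "a \<in> insert u (\<Union>w\<in>E `` {u}. branch E u w)"
    proof (induction rule: rtrancl_induct)
      case (step a b)
      show ?case
      proof (cases "a = u \<or> b = u")
        case True
        then show ?thesis using step branch_self by fastforce
      next
        case False
        then obtain z where z: "z \<in> E `` {u}" "a \<in> branch E u z" using step by auto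
        then have "u \<noteq> z" using arc_neq by auto
        with z False step branch_step have "b \<in> branch E u z" by metis
        then show ?thesis using z by auto
      qed
    qed simp
  qed
qed

subsection \<open>Legs\<close>

text \<open>The list runs outwards to the leaf and omits the attachment vertex \<open>x\<close>.
  Prescribing whole neighbourhoods gives each inner vertex degree 2 and the last one degree 1, while
  the degree of \<open>x\<close> stays free.\<close>

inductive leg :: "'a \<Rightarrow> 'a list \<Rightarrow> bool" where
  leaf: "E `` {y} = {x} \<Longrightarrow> leg x [y]"
| Cons: "E `` {y} = {x, z} \<Longrightarrow> x \<noteq> z \<Longrightarrow> leg y (z # zs) \<Longrightarrow> leg x (y # z # zs)"

lemma leg_single_iff: "leg x [y] \<longleftrightarrow> E `` {y} = {x}"
  by (auto intro: leg.intros elim: leg.cases)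

lemma leg_Cons_iff:
  "leg x (y # z # zs) \<longleftrightarrow> E `` {y} = {x, z} \<and> x \<noteq> z \<and> leg y (z # zs)"
  by (auto intro: leg.intros elim: leg.cases)

lemma leg_nonempty: "leg x ys \<Longrightarrow> ys \<noteq> []"
  by (auto elim: leg.cases)

lemma leg_arc: "leg x ys \<Longrightarrow> (x, hd ys) \<in> E"
  by (erule leg.cases) (use arc_sym in auto)

text \<open>Each vertex of a leg has at most one child, so \<open>branch_decomp\<close> unfolds
  along the list. Distinctness comes along: \<open>y\<close> is not in \<open>branch E y z\<close>,
  which by induction is the rest of the list.\<close>

lemma leg_branch: "leg x ys \<Longrightarrow> branch E x (hd ys) = set ys \<and> distinct ys"
proof (induction rule: leg.induct)
  case (leaf y x)
  then have "(x, y) \<in> E" using arc_sym by auto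
  then show ?case using branch_decomp[of x y] leaf by simp
next
  case (Cons y x z zs)
  then have "(x, y) \<in> E" "(y, z) \<in> E" using arc_sym by auto
  moreover have "E `` {y} - {x} = {z}" using Cons by auto
  ultimately show ?case
    using branch_decomp[of x y] Cons.IH notin_branch[of y z E] arc_neq[of y z] by auto
qed

text \<open>The index shift makes \<open>(x # ys) ! i\<close> the predecessor of
  \<open>ys ! i\<close>, which is \<open>x\<close> itself at \<open>i = 0\<close>. This indexed form
  fits the hypotheses of \<open>rigid_no_swap\<close>.\<close>

lemma leg_nth_neighbours:
  "leg x ys \<Longrightarrow> i < length ys \<Longrightarrow>
     E `` {ys ! i} = insert ((x # ys) ! i) (if Suc i < length ys then {ys ! Suc i} else {})"
proof (induction arbitrary: i rule: leg.induct)
  case (Cons y x z zs)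
  then show ?case by (cases i) auto
qed simp

text \<open>\<open>zip (x # ys) ys\<close> consists of the outward arcs: it pairs each vertex of the
  leg with its predecessor. \<open>spider\<close> is encoded in the same way.\<close>

lemma leg_arcs_subset: "leg x ys \<Longrightarrow> set (zip (x # ys) ys) \<subseteq> E"
  by (induction rule: leg.induct) (auto intro: arc_sym)

lemma leg_arcs_cover:
  "leg x ys \<Longrightarrow> a \<in> set ys \<Longrightarrow> (a, b) \<in> E \<Longrightarrow>
     (a, b) \<in> set (zip (x # ys) ys) \<union> (set (zip (x # ys) ys))\<inverse>"
  by (induction rule: leg.induct) auto

lemma leg_notin: "leg x ys \<Longrightarrow> x \<notin> set ys"
  using leg_branch[of x ys] leg_arc[of x ys] notin_branch arc_neq by metis

lemma legs_disjoint: "leg x ys \<Longrightarrow> leg x zs \<Longrightarrow> hd ys \<noteq> hd zs \<Longrightarrow> set ys \<inter> set zs = {}"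
  using leg_branch[of x ys] leg_branch[of x zs] leg_arc[of x ys] leg_arc[of x zs]
    branch_disjoint by metis

lemma leg_V: "leg x ys \<Longrightarrow> set ys \<subseteq> V"
  using leg_branch[of x ys] leg_arc[of x ys] branch_V arc_V by metis

text \<open>Legs of equal length at \<open>u\<close> can be exchanged position by position. The swap
  fixes \<open>u\<close>, the common predecessor of both heads.\<close>

lemma rigid_legs_length_neq:
  assumes "rigid V E" "leg u xs" "leg u ys" "hd xs \<noteq> hd ys"
  shows "length xs \<noteq> length ys"
proof
  assume len: "length xs = length ys"
  have dist: "distinct (xs @ ys)"
    using leg_branch assms legs_disjoint[OF assms(2-4)] by auto
  note sw = swap_lists_nth_left[OF dist len] swap_lists_nth_right[OF dist len]
  have swu: "swap_lists xs ys u = u"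
    using swap_lists_other[OF dist len] leg_notin assms by auto
  show False
  proof (rule rigid_no_swap[OF assms(1) arcs_V sym_E dist len])
    fix i assume i: "i < length xs"
    show "swap_lists xs ys ` (E `` {xs ! i}) \<subseteq> E `` {ys ! i}"
      using i len unfolding leg_nth_neighbours[OF assms(2) i]
        leg_nth_neighbours[OF assms(3) i[unfolded len]]
      by (cases i) (auto simp: sw swu)
    show "swap_lists xs ys ` (E `` {ys ! i}) \<subseteq> E `` {xs ! i}"
      using i len unfolding leg_nth_neighbours[OF assms(2) i]
        leg_nth_neighbours[OF assms(3) i[unfolded len]]
      by (cases i) (auto simp: sw swu)
  qed (use assms leg_nonempty leg_V in auto)
qed

section \<open>Forks and the number of their leg vertices\<close>

text \<open>The branch through \<open>p\<close> is unconstrained: in a spider it may be a leg as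
  well.\<close>

definition fork :: "'a \<Rightarrow> 'a \<Rightarrow> bool" where
  "fork u p \<longleftrightarrow> (u, p) \<in> E \<and> card (E `` {u}) \<ge> 3 \<and>
     (\<forall>w\<in>E `` {u} - {p}. \<exists>ws. leg u (w # ws))"

lemma finite_neighbours: "finite (E `` {u})"
  using finite_V arcs_V by (meson finite_Image finite_SigmaI finite_subset)

text \<open>Induction on the size of the branch: descend into a child branch that is not a leg; when
  there is none, \<open>y\<close> is a fork whose exceptional neighbour is \<open>x\<close>. The
  conjunct \<open>x \<in> branch E u p\<close> records that the exceptional side looks back to the
  start, which later makes two forks face each other.\<close>

lemma leg_or_fork:
  assumes "(x, y) \<in> E" "\<nexists>ys. leg x (y # ys)"
  shows "\<exists>u p. u \<in> branch E x y \<and> fork u p \<and> x \<in> branch E u p"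
  using assms
proof (induction "card (branch E x y)" arbitrary: x y rule: less_induct)
  case less
  show ?case
  proof (cases "\<exists>z\<in>E `` {y} - {x}. \<nexists>zs. leg y (z # zs)")
    case True
    then obtain z where z: "(y, z) \<in> E" "z \<noteq> x" "\<nexists>zs. leg y (z # zs)" by auto
    have sub: "branch E y z \<subseteq> branch E x y" using branch_child_subset less z by blast
    moreover have "y \<in> branch E x y" "y \<notin> branch E y z"
      using branch_self notin_branch arc_neq z by metis+
    moreover have "finite (branch E x y)"
      using branch_V less.prems arc_V finite_V finite_subset by metis
    ultimately have "card (branch E y z) < card (branch E x y)" by (metis psubsetI psubset_card_mono)
    from less.hyps[OF this z(1,3)] obtain u p
      where u: "u \<in> branch E y z" "fork u p" "y \<in> branch E u p" by blast
    have "x \<notin> branch E y z" using branch_separates[of y z x] z less.prems arc_sym by auto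
    then have "x \<noteq> u" using u by auto
    moreover have "u \<noteq> p" using u(2) arc_neq fork_def by metis
    ultimately have "x \<in> branch E u p" using branch_step u(3) less.prems(1) arc_sym by metis
    then show ?thesis using u sub by auto
  next
    case False
    \<comment> \<open>Without children \<open>y\<close> is a leaf, and a single child starting a leg
      extends that leg by \<open>y\<close>; so failing to be a leg forces two children.\<close>
    have "\<exists>ys. leg x (y # ys)" if "card (E `` {y} - {x}) \<le> 1"
    proof -
      have "x \<in> E `` {y}" using less.prems arc_sym by auto
      have fin: "finite (E `` {y} - {x})" using finite_neighbours by auto
      from that consider "card (E `` {y} - {x}) = 0" | "card (E `` {y} - {x}) = 1" by linarith
      then consider "E `` {y} - {x} = {}" | z where "E `` {y} - {x} = {z}"
        by cases (use fin card_1_singletonE in auto)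
      then show ?thesis
      proof cases
        case 1
        then have "E `` {y} = {x}" using \<open>x \<in> E `` {y}\<close> by auto
        then show ?thesis by (auto intro: leg.intros)
      next
        case 2
        then have "E `` {y} = {x, z}" "x \<noteq> z" using \<open>x \<in> E `` {y}\<close> by auto
        moreover obtain zs where "leg y (z # zs)" using False 2 by auto
        ultimately show ?thesis by (auto intro: leg.intros)
      qed
    qed
    then have "card (E `` {y} - {x}) \<ge> 2" using less.prems by force
    moreover have "x \<in> E `` {y}" using less.prems arc_sym by auto
    ultimately have "card (E `` {y}) \<ge> 3" using finite_neighbours[of y] by simp
    then have "fork y x" using False less.prems arc_sym by (auto simp: fork_def)
    then show ?thesis using branch_self by metis
  qed
qed

text \<open>The legs have pairwise distinct positive lengths, so two of them need 1 + 2 = 3 vertices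
  and three need 1 + 2 + 3 = 6. This is the origin of both bounds.\<close>

lemma rigid_fork_legs:
  assumes "rigid V E" "fork u p"
  defines "B \<equiv> \<Union>w\<in>E `` {u} - {p}. branch E u w"
  shows "card B \<ge> 3"
    and "card B < 6 \<Longrightarrow> \<exists>xs ys. leg u xs \<and> leg u ys \<and> length xs < length ys \<and>
      E `` {u} = {p, hd xs, hd ys} \<and> hd xs \<noteq> hd ys \<and> hd xs \<noteq> p \<and> hd ys \<noteq> p \<and>
      B = set xs \<union> set ys"
proof -
  let ?A = "E `` {u} - {p}"
  define L where "L = (\<lambda>w. SOME ys. leg u ys \<and> hd ys = w)"
  have L: "leg u (L w) \<and> hd (L w) = w" if "w \<in> ?A" for w
  proof -
    from that assms(2) obtain ws where "leg u (w # ws)" unfolding fork_def by blast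
    then have "leg u (w # ws) \<and> hd (w # ws) = w" by simp
    then show ?thesis unfolding L_def by (rule someI)
  qed
  have finA: "finite ?A" using finite_neighbours by simp
  have cardA: "card ?A \<ge> 2"
    using assms(2) finite_neighbours[of u] by (simp add: fork_def) linarith
  let ?l = "\<lambda>w. length (L w)"
  have inj: "inj_on ?l ?A"
  proof (rule inj_onI, rule ccontr)
    fix x y assume "x \<in> ?A" "y \<in> ?A" "?l x = ?l y" "x \<noteq> y"
    then show False using L rigid_legs_length_neq[OF assms(1)] by metis
  qed
  have pos: "?l w \<ge> 1" if "w \<in> ?A" for w
    using L[OF that] leg_nonempty[of u "L w"] by (cases "L w") auto
  have br: "branch E u w = set (L w) \<and> distinct (L w)" if "w \<in> ?A" for w
    using L[OF that] leg_branch[of u "L w"] by simp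
  then have "B = (\<Union>w\<in>?A. set (L w))" by (simp add: B_def)
  also have "card \<dots> = (\<Sum>w\<in>?A. card (set (L w)))"
  proof (rule card_UN_disjoint[OF finA])
    show "\<forall>x\<in>?A. \<forall>y\<in>?A. x \<noteq> y \<longrightarrow> set (L x) \<inter> set (L y) = {}"
      using L legs_disjoint by metis
  qed auto
  also have "\<dots> = sum ?l ?A" using br by (simp add: distinct_card)
  finally have card_B: "card B = sum ?l ?A" .
  have sub: "sum ?l A' \<le> card B" if "A' \<subseteq> ?A" for A'
    unfolding card_B using that finA by (intro sum_mono2) auto
  obtain A' where A': "A' \<subseteq> ?A" "card A' = 2" using cardA by (meson obtain_subset_with_card_n)
  then obtain x y where xy: "A' = {x, y}" "x \<noteq> y" by (meson card_2_iff)
  have "?l x + ?l y \<le> card B" using sub[OF A'(1)] xy by simp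
  moreover have "?l x \<noteq> ?l y" "?l x \<ge> 1" "?l y \<ge> 1"
    using A' xy inj pos by (auto dest: inj_onD)
  ultimately show "card B \<ge> 3" by linarith
  assume "card B < 6"
  have "\<not> card ?A \<ge> 3"
  proof
    assume "card ?A \<ge> 3"
    then obtain C where C: "C \<subseteq> ?A" "card C = 3" by (meson obtain_subset_with_card_n)
    then obtain a b c where abc: "C = {a, b, c}" "a \<noteq> b" "a \<noteq> c" "b \<noteq> c" by (auto simp: card_3_iff)
    have "?l a + ?l b + ?l c \<le> card B" using sub[OF C(1)] abc by simp
    moreover have "?l a \<noteq> ?l b" "?l a \<noteq> ?l c" "?l b \<noteq> ?l c" "?l a \<ge> 1" "?l b \<ge> 1" "?l c \<ge> 1"
      using C abc inj pos by (auto dest: inj_onD)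
    ultimately show False using \<open>card B < 6\<close> by linarith
  qed
  then have "card ?A = 2" using cardA by simp
  then have "?A = A'" using A' finA by (metis card_subset_eq)
  obtain x' y' where xy': "A' = {x', y'}" "x' \<noteq> y'" "?l x' < ?l y'"
  proof (cases "?l x < ?l y")
    case True
    show ?thesis by (rule that[of x y]) (use xy True in auto)
  next
    case False
    show ?thesis by (rule that[of y x]) (use xy False \<open>?l x \<noteq> ?l y\<close> in auto)
  qed
  have mem: "x' \<in> ?A" "y' \<in> ?A" using xy' \<open>?A = A'\<close> by auto
  have "E `` {u} = {p, x', y'}"
    using xy' \<open>?A = A'\<close> assms(2) unfolding fork_def by auto
  moreover have "B = set (L x') \<union> set (L y')"
    unfolding B_def \<open>?A = A'\<close> using xy' br[OF mem(1)] br[OF mem(2)] by auto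
  ultimately have "leg u (L x') \<and> leg u (L y') \<and> ?l x' < ?l y' \<and>
      E `` {u} = {p, hd (L x'), hd (L y')} \<and> hd (L x') \<noteq> hd (L y') \<and> hd (L x') \<noteq> p \<and>
      hd (L y') \<noteq> p \<and> B = set (L x') \<union> set (L y')"
    using L[OF mem(1)] L[OF mem(2)] xy' mem by simp
  then show "\<exists>xs ys. leg u xs \<and> leg u ys \<and> length xs < length ys \<and>
      E `` {u} = {p, hd xs, hd ys} \<and> hd xs \<noteq> hd ys \<and> hd xs \<noteq> p \<and> hd ys \<noteq> p \<and>
      B = set xs \<union> set ys"
    by blast
qed

text \<open>At a fork only the branch through \<open>p\<close> can fail to be a leg, so the
  assumption at \<open>u\<close> singles out \<open>p\<close>. Descending there yields a second
  fork, whose exceptional side contains \<open>u\<close>.\<close>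

lemma two_forks:
  assumes "r \<in> V" "\<And>u. u \<in> V \<Longrightarrow> \<exists>w\<in>E `` {u}. \<nexists>ws. leg u (w # ws)"
  obtains u p v q where "fork u p" "fork v q" "v \<in> branch E u p" "u \<in> branch E v q"
proof -
  obtain w where "(r, w) \<in> E" "\<nexists>ws. leg r (w # ws)" using assms by blast
  from leg_or_fork[OF this] obtain u p where u: "fork u p" by blast
  then have "u \<in> V" using arc_V fork_def by metis
  then obtain w where w: "(u, w) \<in> E" "\<nexists>ws. leg u (w # ws)" using assms by blast
  with u have "w = p" unfolding fork_def by blast
  with leg_or_fork[OF w] u that show ?thesis by blast
qed

text \<open>The vertex \<open>u\<close> lies on the \<open>q\<close> side of \<open>v\<close>, so
  the other branches at \<open>v\<close> avoid \<open>u\<close> and stay inside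
  \<open>branch E u p\<close>.\<close>

lemma fork_branches_disjoint:
  assumes "fork u p" "fork v q" "v \<in> branch E u p" "u \<in> branch E v q"
  shows "(\<Union>w\<in>E `` {u} - {p}. branch E u w) \<inter> insert v (\<Union>w\<in>E `` {v} - {q}. branch E v w) = {}"
proof -
  have arcs: "(u, p) \<in> E" "(v, q) \<in> E" using assms fork_def by auto
  have "branch E v w \<subseteq> branch E u p" if w: "w \<in> E `` {v} - {q}" for w
  proof (rule branch_subset)
    have "u \<notin> branch E v w" using branch_disjoint[of v w q] w arcs assms(4) by auto
    then show "u \<notin> branch E v w" .
    moreover have "w \<in> branch E v w" by (rule branch_self)
    ultimately have "w \<noteq> u" by auto
    then show "w \<in> branch E u p"
      using branch_step[OF assms(3)] w arcs arc_neq by auto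
  qed (use w arcs arc_neq in auto)
  then have "insert v (\<Union>w\<in>E `` {v} - {q}. branch E v w) \<subseteq> branch E u p"
    using assms(3) by auto
  moreover have "branch E u p \<inter> (\<Union>w\<in>E `` {u} - {p}. branch E u w) = {}"
    using branch_disjoint[of u p] arcs by blast
  ultimately show ?thesis by blast
qed

lemma small_two_forks:
  assumes "rigid V E" "card V \<le> 9"
    and forks: "fork u p" "fork v q" "v \<in> branch E u p" "u \<in> branch E v q"
    and le: "card (\<Union>w\<in>E `` {u} - {p}. branch E u w) \<le> card (\<Union>w\<in>E `` {v} - {q}. branch E v w)"
  shows "\<exists>a b b' c d d' d''. distinct [u, a, b, b', v, c, d, d', d''] \<and>
    V = {u, a, b, b', v, c, d, d', d''} \<and>
    E `` {u} = {v, a, b} \<and> E `` {a} = {u} \<and> E `` {b} = {u, b'} \<and> E `` {b'} = {b} \<and>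
    E `` {v} = {u, c, d} \<and> E `` {c} = {v} \<and> E `` {d} = {v, d'} \<and> E `` {d'} = {d, d''} \<and>
    E `` {d''} = {d'}"
proof -
  let ?B = "\<Union>w\<in>E `` {u} - {p}. branch E u w" and ?C = "\<Union>w\<in>E `` {v} - {q}. branch E v w"
  have arcs: "(u, p) \<in> E" "(v, q) \<in> E" using forks fork_def by auto
  then have uvV: "u \<in> V" "v \<in> V" "p \<in> V" "q \<in> V" using arc_V by auto
  have BV: "?B \<subseteq> V" "?C \<subseteq> V" using branch_V arc_V by blast+
  have fin: "finite ?B" "finite ?C" using BV finite_V finite_subset by metis+
  have disj1: "?B \<inter> insert v ?C = {}" by (rule fork_branches_disjoint[OF forks])
  have disj2: "?C \<inter> insert u ?B = {}"
    by (rule fork_branches_disjoint[OF forks(2,1) forks(4,3)])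
  have "u \<notin> ?B" "v \<notin> ?C" using notin_branch[of _ _ E] arc_neq by fastforce+
  have "u \<noteq> v" using forks(3) notin_branch arc_neq arcs by metis
  have card4: "card (insert u (insert v (?B \<union> ?C))) = 2 + card ?B + card ?C"
  proof -
    have "card (insert u (insert v (X \<union> Y))) = 2 + card X + card Y"
      if "finite X" "finite Y" "u \<notin> insert v (X \<union> Y)" "v \<notin> X \<union> Y" "X \<inter> Y = {}" for X Y
      using that by (simp add: card_Un_disjoint)
    moreover have "u \<notin> insert v (?B \<union> ?C)" "v \<notin> ?B \<union> ?C" "?B \<inter> ?C = {}"
      using disj1 disj2 \<open>u \<notin> ?B\<close> \<open>v \<notin> ?C\<close> \<open>u \<noteq> v\<close> by blast+
    ultimately show ?thesis using fin by blast
  qed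
  have sub4: "insert u (insert v (?B \<union> ?C)) \<subseteq> V" using uvV BV by auto
  then have "2 + card ?B + card ?C \<le> 9"
    using card_mono[OF finite_V sub4] card4 assms(2) by simp
  \<comment> \<open>At most 7 vertices are on legs and each end has at least 3; as \<open>u\<close>
    has the smaller end, the sizes are 3 and 3, or 3 and 4.\<close>
  then have small: "card ?B < 6" "card ?C < 6" "card ?B = 3" "card ?C \<le> 4"
    using rigid_fork_legs(1)[OF assms(1) forks(1)] rigid_fork_legs(1)[OF assms(1) forks(2)] le
    by linarith+
  obtain xs ys where xy: "leg u xs" "leg u ys" "length xs < length ys"
      "E `` {u} = {p, hd xs, hd ys}" "hd xs \<noteq> hd ys" "hd xs \<noteq> p" "hd ys \<noteq> p" "?B = set xs \<union> set ys"
    using rigid_fork_legs(2)[OF assms(1) forks(1) small(1)] by blast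
  obtain zs ws where zw: "leg v zs" "leg v ws" "length zs < length ws"
      "E `` {v} = {q, hd zs, hd ws}" "hd zs \<noteq> hd ws" "hd zs \<noteq> q" "hd ws \<noteq> q" "?C = set zs \<union> set ws"
    using rigid_fork_legs(2)[OF assms(1) forks(2) small(2)] by blast
  have dxy: "distinct (xs @ ys)" using leg_branch xy legs_disjoint by auto
  have dzw: "distinct (zs @ ws)" using leg_branch zw legs_disjoint by auto
  have "card ?B = length xs + length ys" using distinct_card[OF dxy] xy(8) by simp
  moreover have "card ?C = length zs + length ws" using distinct_card[OF dzw] zw(8) by simp
  moreover have "length xs \<noteq> 0" "length zs \<noteq> 0" using leg_nonempty xy(1) zw(1) by auto
  ultimately have lens: "length xs = 1" "length ys = 2" "length zs = 1" "length ws = 2 \<or> length ws = 3"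
    using small(3,4) xy(3) zw(3) by linarith+
  obtain a where a: "xs = [a]" using lens(1) by (auto simp: length_Suc_conv)
  obtain b b' where b: "ys = [b, b']" using lens(2) by (auto simp: length_Suc_conv numeral_2_eq_2)
  obtain c where c: "zs = [c]" using lens(3) by (auto simp: length_Suc_conv)
  have N1: "E `` {u} = {p, a, b}" "E `` {a} = {u}" "E `` {b} = {u, b'}" "E `` {b'} = {b}"
    using xy a b by (auto simp: leg_single_iff leg_Cons_iff)
  \<comment> \<open>Either \<open>u\<close> and \<open>v\<close> are adjacent and \<open>up\<close>, \<open>vq\<close> are the same edge, or \<open>p\<close> and \<open>q\<close> both lie outside
    the legs, where at most one vertex is left, so that \<open>p = q\<close>.\<close>
  have pv_iff: "p = v \<longleftrightarrow> q = u"
  proof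
    assume "p = v"
    show "q = u"
      using branch_disjoint[of v u q] branch_self[of u E v] arcs arc_sym forks(4) \<open>p = v\<close> by blast
  next
    assume "q = u"
    show "p = v"
      using branch_disjoint[of u v p] branch_self[of v E u] arcs arc_sym forks(3) \<open>q = u\<close> by blast
  qed
  have pB: "p \<notin> ?B" using branch_disjoint[of u p] branch_self[of p E u] arcs by blast
  have qC: "q \<notin> ?C" using branch_disjoint[of v q] branch_self[of q E v] arcs by blast
  \<comment> \<open>A branch at \<open>v\<close> containing \<open>p\<close> would also contain
    \<open>u\<close>, its neighbour, although \<open>u\<close> lies on the \<open>q\<close>
    side.\<close>
  have pC: "p \<notin> ?C"
  proof
    assume "p \<in> ?C"
    then obtain w where w: "w \<in> E `` {v} - {q}" "p \<in> branch E v w" by auto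
    then have "u \<in> branch E v w"
      using branch_step[OF w(2), of u] arcs arc_sym arc_neq \<open>u \<noteq> v\<close> by auto
    then show False using disj2 w by auto
  qed
  have qB: "q \<notin> ?B"
  proof
    assume "q \<in> ?B"
    then obtain w where w: "w \<in> E `` {u} - {p}" "q \<in> branch E u w" by auto
    then have "v \<in> branch E u w"
      using branch_step[OF w(2), of v] arcs arc_sym arc_neq \<open>u \<noteq> v\<close> by auto
    then show False using disj1 w by auto
  qed
  have sets: "?B = {a, b, b'}" "?C = {c} \<union> set ws" using xy(8) zw(8) a b c by auto
  from lens(4) show ?thesis
  proof
    assume "length ws = 2"
    then obtain d d' where d: "ws = [d, d']" by (auto simp: length_Suc_conv numeral_2_eq_2)
    have N2: "E `` {v} = {q, c, d}" "E `` {c} = {v}" "E `` {d} = {v, d'}" "E `` {d'} = {d}"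
      using zw c d by (auto simp: leg_single_iff leg_Cons_iff)
    \<comment> \<open>Equal positions play equal roles: branching vertex, leg of length 1, leg of
      length 2.\<close>
    let ?xs = "[u, a, b, b']" and ?ys = "[v, c, d, d']"
    have dist: "distinct (?xs @ ?ys)"
      using dxy dzw disj1 disj2 \<open>u \<noteq> v\<close> \<open>u \<notin> ?B\<close> \<open>v \<notin> ?C\<close>
      unfolding sets d by (auto simp: a b c d)
    have len: "length ?xs = length ?ys" by simp
    note sw = swap_lists_nth_left[OF dist len] swap_lists_nth_right[OF dist len]
    have sw1: "swap_lists ?xs ?ys u = v" "swap_lists ?xs ?ys a = c"
        "swap_lists ?xs ?ys b = d" "swap_lists ?xs ?ys b' = d'"
      using sw(1)[of 0] sw(1)[of 1] sw(1)[of 2] sw(1)[of 3] by simp_all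
    have sw2: "swap_lists ?xs ?ys v = u" "swap_lists ?xs ?ys c = a"
        "swap_lists ?xs ?ys d = b" "swap_lists ?xs ?ys d' = b'"
      using sw(2)[of 0] sw(2)[of 1] sw(2)[of 2] sw(2)[of 3] by simp_all
    have swp: "swap_lists ?xs ?ys p = q" "swap_lists ?xs ?ys q = p"
    proof -
      have "swap_lists ?xs ?ys p = q \<and> swap_lists ?xs ?ys q = p"
      proof (cases "p = v")
        case True
        then show ?thesis using pv_iff sw1 sw2 by auto
      next
        case False
        let ?W = "{u, a, b, b', v, c, d, d'}"
        have pq: "p \<notin> ?W" "q \<notin> ?W"
          using False pv_iff pB pC qB qC arcs arc_neq[of u p] arc_neq[of v q] unfolding sets d by auto
        have "card ?W = 8" using dist by auto
        moreover have "card (V - ?W) = card V - card ?W"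
          using sub4 unfolding sets d by (intro card_Diff_subset) auto
        ultimately have "card (V - ?W) \<le> Suc 0" using assms(2) by simp
        then have "\<forall>x\<in>V - ?W. \<forall>y\<in>V - ?W. x = y"
          using finite_V card_le_Suc0_iff_eq[of "V - ?W"] by blast
        moreover have "p \<in> V - ?W" "q \<in> V - ?W" using pq uvV by blast+
        ultimately have "p = q" by blast
        moreover have "swap_lists ?xs ?ys p = p"
          using swap_lists_other[OF dist len] pq by auto
        ultimately show ?thesis by auto
      qed
      then show "swap_lists ?xs ?ys p = q" "swap_lists ?xs ?ys q = p" by auto
    qed
    have False
    proof (rule rigid_no_swap[OF assms(1) arcs_V sym_E dist len])
      show "set ?xs \<union> set ?ys \<subseteq> V" using sub4 unfolding sets d by auto
    next
      fix i assume "i < length ?xs"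
      then consider "i = 0" | "i = 1" | "i = 2" | "i = 3" by fastforce
      note cases = this
      from cases show "swap_lists ?xs ?ys ` (E `` {?xs ! i}) \<subseteq> E `` {?ys ! i}"
        by cases (simp_all add: N1 N2 sw1 sw2 swp)
      from cases show "swap_lists ?xs ?ys ` (E `` {?ys ! i}) \<subseteq> E `` {?xs ! i}"
        by cases (simp_all add: N1 N2 sw1 sw2 swp)
    qed simp
    then show ?thesis ..
  next
    assume "length ws = 3"
    then obtain d d' d'' where d: "ws = [d, d', d'']" by (auto simp: length_Suc_conv numeral_3_eq_3)
    have N2: "E `` {v} = {q, c, d}" "E `` {c} = {v}" "E `` {d} = {v, d'}" "E `` {d'} = {d, d''}"
        "E `` {d''} = {d'}"
      using zw c d by (auto simp: leg_single_iff leg_Cons_iff)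
    have dist: "distinct [u, a, b, b', v, c, d, d', d'']"
      using dxy dzw disj1 disj2 \<open>u \<noteq> v\<close> \<open>u \<notin> ?B\<close> \<open>v \<notin> ?C\<close>
      unfolding sets d by (auto simp: a b c d)
    let ?W = "{u, a, b, b', v, c, d, d', d''}"
    have "?W \<subseteq> V" using sub4 unfolding sets d by auto
    moreover have "card ?W = 9" using dist by auto
    ultimately have V: "V = ?W"
      using assms(2) finite_V by (metis card_seteq)
    \<comment> \<open>No vertex is left over, and \<open>p\<close> is neither \<open>u\<close> nor
      on a leg.\<close>
    then have "p = v"
      using uvV(3) pB pC arc_neq[OF arcs(1)] unfolding sets d by auto
    then have "q = u" using pv_iff by simp
    show ?thesis
      using dist V N1 N2 \<open>p = v\<close> \<open>q = u\<close> by blast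
  qed
qed

end

section \<open>Spiders\<close>

definition spider :: "'a \<Rightarrow> 'a list set \<Rightarrow> 'a pair_pre_digraph" where
  "spider u L = \<lparr> pverts = insert u (\<Union>ys\<in>L. set ys),
     parcs = (\<Union>ys\<in>L. set (zip (u # ys) ys) \<union> (set (zip (u # ys) ys))\<inverse>) \<rparr>"

text \<open>\<open>L \<noteq> {}\<close> corresponds to \<open>m \<ge> 1\<close> for the star
  underneath.\<close>

definition spider_legs :: "'a \<Rightarrow> 'a list set \<Rightarrow> bool" where
  "spider_legs u L \<longleftrightarrow> finite L \<and> L \<noteq> {} \<and> (\<forall>ys\<in>L. ys \<noteq> [] \<and> distinct (u # ys)) \<and>
     (\<forall>ys\<in>L. \<forall>zs\<in>L. ys \<noteq> zs \<longrightarrow> set ys \<inter> set zs = {})"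

lemma spider_legsD:
  assumes "spider_legs u L"
  shows "finite L" "L \<noteq> {}" "ys \<in> L \<Longrightarrow> ys \<noteq> []" "ys \<in> L \<Longrightarrow> distinct (u # ys)"
    and "ys \<in> L \<Longrightarrow> zs \<in> L \<Longrightarrow> ys \<noteq> zs \<Longrightarrow> set ys \<inter> set zs = {}"
  using assms unfolding spider_legs_def by blast+

lemma path_arc_mem: "(a, b) \<in> set (zip (u # ys) ys) \<Longrightarrow> a \<in> insert u (set ys) \<and> b \<in> set ys"
  using set_zip_leftD[of a b "u # ys" ys] set_zip_rightD[of a b "u # ys" ys] by simp

text \<open>Dropping the innermost vertex \<open>y\<close> of a leg undoes a subdivision of the edge
  between the centre \<open>u\<close> and \<open>z\<close>. Working at the centre suits the lists,
  which begin there.\<close>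

lemma spider_shorten_leg:
  assumes "spider_legs u (insert (y # z # zs) L)" "y # z # zs \<notin> L"
  shows "spider_legs u (insert (z # zs) L)" "z # zs \<notin> L"
    and "edge_subdivision (spider u (insert (z # zs) L)) (spider u (insert (y # z # zs) L))"
proof -
  let ?P = "set (zip (z # zs) zs)"
  let ?R = "\<Union>ys\<in>L. set (zip (u # ys) ys) \<union> (set (zip (u # ys) ys))\<inverse>"
  let ?VL = "\<Union>ys\<in>L. set ys"
  have dist: "distinct (u # y # z # zs)"
    by (rule spider_legsD(4)[OF assms(1)]) simp
  have disj: "set (y # z # zs) \<inter> set ys = {}" if "ys \<in> L" for ys
    by (rule spider_legsD(5)[OF assms(1)]) (use that assms(2) in auto)
  have leg_L: "ys \<noteq> []" "distinct (u # ys)" if "ys \<in> L" for ys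
    using spider_legsD(3,4)[OF assms(1), of ys] that by simp_all
  show "spider_legs u (insert (z # zs) L)"
    unfolding spider_legs_def
  proof (intro conjI ballI impI)
    show "finite (insert (z # zs) L)" using spider_legsD(1)[OF assms(1)] by simp
  next
    fix ys assume "ys \<in> insert (z # zs) L"
    then show "ys \<noteq> []" "distinct (u # ys)" using leg_L dist by auto
  next
    fix xs ys assume xs: "xs \<in> insert (z # zs) L" "ys \<in> insert (z # zs) L" "xs \<noteq> ys"
    consider "xs \<in> L" "ys \<in> L" | "xs \<in> L" "ys = z # zs" | "xs = z # zs" "ys \<in> L"
      using xs by blast
    then show "set xs \<inter> set ys = {}"
    proof cases
      case 1
      then show ?thesis by (intro spider_legsD(5)[OF assms(1)]) (use xs in auto)
    next
      case 2
      then show ?thesis using disj[of xs] by auto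
    next
      case 3
      then show ?thesis using disj[of ys] by auto
    qed
  qed simp
  show "z # zs \<notin> L" using disj[of "z # zs"] by auto
  have R: "a \<in> insert u ?VL \<and> b \<in> insert u ?VL" if "(a, b) \<in> ?R" for a b
    using that by (auto dest: path_arc_mem)
  have P: "a \<in> set (z # zs) \<and> b \<in> set (z # zs)" if "(a, b) \<in> ?P" for a b
    using path_arc_mem[OF that] by simp
  have zVL: "z \<notin> ?VL" "y \<notin> ?VL" using disj by auto
  \<comment> \<open>\<open>subdivide\<close> removes both arcs between \<open>u\<close> and
    \<open>z\<close>; these must not occur elsewhere, or arcs of the longer spider would be
    lost.\<close>
  have new: "(u, z) \<notin> ?R \<union> ?P \<union> ?P\<inverse>" "(z, u) \<notin> ?R \<union> ?P \<union> ?P\<inverse>"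
    using R[of u z] R[of z u] P[of u z] P[of z u] zVL dist by auto
  have arcs1: "parcs (spider u (insert (z # zs) L)) = ?R \<union> ?P \<union> ?P\<inverse> \<union> {(u, z), (z, u)}"
    by (auto simp: spider_def)
  have arcs2: "parcs (spider u (insert (y # z # zs) L)) =
      ?R \<union> ?P \<union> ?P\<inverse> \<union> {(u, y), (y, u), (y, z), (z, y)}"
    by (auto simp: spider_def)
  have "spider u (insert (y # z # zs) L) = subdivide (spider u (insert (z # zs) L)) (u, z) y"
  proof (rule pair_pre_digraph.equality)
    show "parcs (spider u (insert (y # z # zs) L)) =
        parcs (subdivide (spider u (insert (z # zs) L)) (u, z) y)"
      unfolding arcs_subdivide arcs1 arcs2 using new by blast
    show "pverts (spider u (insert (y # z # zs) L)) =
        pverts (subdivide (spider u (insert (z # zs) L)) (u, z) y)"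
      by (auto simp: spider_def)
  qed simp
  moreover have "(u, z) \<in> parcs (spider u (insert (z # zs) L))" unfolding arcs1 by simp
  moreover have "y \<notin> pverts (spider u (insert (z # zs) L))"
    using zVL dist by (auto simp: spider_def)
  ultimately show "edge_subdivision (spider u (insert (z # zs) L)) (spider u (insert (y # z # zs) L))"
    unfolding edge_subdivision_def by blast
qed

text \<open>Induction on the total leg length, which each shortening decreases. The closure is
  reflexive because \<open>L\<close> may already be a star.\<close>

lemma spider_from_star:
  assumes "spider_legs u L"
  shows "\<exists>L'. spider_legs u L' \<and> (\<forall>ys\<in>L'. length ys = 1) \<and>
    edge_subdivision\<^sup>*\<^sup>* (spider u L') (spider u L)"
  using assms
proof (induction "sum length L" arbitrary: L rule: less_induct)
  case less
  show ?case
  proof (cases "\<forall>ys\<in>L. length ys = 1")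
    case True
    then show ?thesis using less.prems by blast
  next
    case False
    then obtain ys where ys: "ys \<in> L" "length ys \<noteq> 1" by blast
    moreover have "ys \<noteq> []" by (rule spider_legsD(3)[OF less.prems ys(1)])
    ultimately obtain y z zs where yz: "ys = y # z # zs"
      by (cases ys rule: list.exhaust; cases "tl ys") auto
    define K where "K = L - {ys}"
    have L: "L = insert (y # z # zs) K" "y # z # zs \<notin> K" using ys yz K_def by auto
    note short = spider_shorten_leg[OF less.prems[unfolded L(1)] L(2)]
    have "finite K" using spider_legsD(1)[OF less.prems] K_def by simp
    then have "sum length (insert (z # zs) K) < sum length L"
      using short(2) L by simp
    from less.hyps[OF this short(1)] show ?thesis
      using short(3) unfolding L(1)[symmetric] by (meson rtranclp.rtrancl_into_rtrancl)
  qed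
qed

text \<open>Two leaves can be exchanged; with a single leaf, the leaf and the centre can.\<close>

lemma star_not_rigid:
  assumes "u \<notin> W" "W \<noteq> {}"
  shows "\<not> rigid (insert u W) ({u} \<times> W \<union> W \<times> {u})"
proof
  let ?V = "insert u W" and ?E = "{u} \<times> W \<union> W \<times> {u}"
  assume r: "rigid ?V ?E"
  obtain x where x: "x \<in> W" using assms by auto
  show False
  proof (cases "W = {x}")
    case True
    let ?f = "id(u := x, x := u)"
    have "?f u = u"
      by (rule rigid_involution[where f = ?f, OF r]) (use True assms(1) in auto)
    then show False using x assms(1) by (auto split: if_splits)
  next
    case False
    then obtain y where y: "y \<in> W" "y \<noteq> x" using x by auto
    let ?f = "id(y := x, x := y)"
    have "?f x = x"
      by (rule rigid_involution[where f = ?f, OF r]) (use x y assms(1) in \<open>auto split: if_splits\<close>)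
    then show False using y by auto
  qed
qed

text \<open>Rigidity supplies the one subdivision that the reflexive closure does not guarantee: a
  star is not rigid, so the spider differs from the star it comes from.\<close>

lemma rigid_spider_subdivided_star:
  assumes "spider_legs u L" "rigid (pverts (spider u L)) (parcs (spider u L))"
  shows "subdivided_star (spider u L)"
proof -
  obtain L' where L': "spider_legs u L'" "\<forall>ys\<in>L'. length ys = 1"
    "edge_subdivision\<^sup>*\<^sup>* (spider u L') (spider u L)"
    using spider_from_star[OF assms(1)] by blast
  define W where "W = (\<Union>ys\<in>L'. set ys)"
  have W: "finite W" "u \<notin> W" "W \<noteq> {}"
  proof -
    show "finite W" using spider_legsD(1)[OF L'(1)] by (simp add: W_def)
    show "u \<notin> W" using spider_legsD(4)[OF L'(1)] unfolding W_def by auto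
    show "W \<noteq> {}" using spider_legsD(2,3)[OF L'(1)] unfolding W_def by auto
  qed
  have V: "pverts (spider u L') = insert u W" by (simp add: spider_def W_def)
  have single: "\<exists>y. ys = [y]" if "ys \<in> L'" for ys
    using L'(2) that by (auto simp: length_Suc_conv)
  have "L' = (\<lambda>y. [y]) ` W"
  proof
    show "L' \<subseteq> (\<lambda>y. [y]) ` W" using single by (force simp: W_def)
    show "(\<lambda>y. [y]) ` W \<subseteq> L'" using single by (force simp: W_def)
  qed
  then have E: "parcs (spider u L') = {u} \<times> W \<union> W \<times> {u}"
    by (auto simp: spider_def)
  have "complete_bipartite_digraph 1 (card W) (with_proj (spider u L'))"
    unfolding complete_bipartite_digraph_pair_def V E
    using W by (intro conjI exI[of _ "{u}"] exI[of _ W]) auto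
  moreover have "card W \<ge> 1" using W by (simp add: Suc_leI card_gt_0_iff)
  moreover have "spider u L' \<noteq> spider u L"
    using star_not_rigid[OF W(2,3)] assms(2) V E by metis
  ultimately show ?thesis
    using L'(3) unfolding subdivided_star_def by (metis rtranclpD)
qed

lemma (in tree_rel) all_legs_spider:
  assumes "u \<in> V" "E `` {u} \<noteq> {}" "\<And>w. w \<in> E `` {u} \<Longrightarrow> \<exists>ws. leg u (w # ws)"
  obtains L where "spider_legs u L" "V = pverts (spider u L)" "E = parcs (spider u L)"
proof -
  define l where "l = (\<lambda>w. SOME ys. leg u ys \<and> hd ys = w)"
  have l: "leg u (l w) \<and> hd (l w) = w" if "w \<in> E `` {u}" for w
  proof -
    from assms(3)[OF that] obtain ws where "leg u (w # ws) \<and> hd (w # ws) = w" by auto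
    then show ?thesis unfolding l_def by (rule someI)
  qed
  have br: "branch E u w = set (l w)" if "w \<in> E `` {u}" for w
    using l[OF that] leg_branch[of u "l w"] by simp
  show thesis
  proof (rule that)
    show "spider_legs u (l ` (E `` {u}))"
      unfolding spider_legs_def
    proof (intro conjI ballI impI)
      fix ys zs assume "ys \<in> l ` (E `` {u})" "zs \<in> l ` (E `` {u})" "ys \<noteq> zs"
      then obtain w w' where w: "w \<in> E `` {u}" "w' \<in> E `` {u}" "ys = l w" "zs = l w'" "w \<noteq> w'"
        by auto
      show "set ys \<inter> set zs = {}"
        unfolding w(3,4) using legs_disjoint[of u "l w" "l w'"] l[OF w(1)] l[OF w(2)] w(5) by simp
    next
      fix ys assume "ys \<in> l ` (E `` {u})"
      then have "leg u ys" using l by auto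
      then show "ys \<noteq> []" "distinct (u # ys)"
        using leg_nonempty leg_notin leg_branch by auto
    qed (use assms(2) finite_neighbours in auto)
    show V: "V = pverts (spider u (l ` (E `` {u})))"
      using vertices_decomp[OF assms(1)] br by (simp add: spider_def)
    show "E = parcs (spider u (l ` (E `` {u})))"
    proof
      show "parcs (spider u (l ` (E `` {u}))) \<subseteq> E"
      proof -
        have "set (zip (u # l w) (l w)) \<subseteq> E" if "w \<in> E `` {u}" for w
          using l[OF that] leg_arcs_subset by blast
        then show ?thesis unfolding spider_def using arc_sym by fastforce
      qed
      have in_leg: "(a, b) \<in> parcs (spider u (l ` (E `` {u})))"
        if "a \<in> set (l w)" "w \<in> E `` {u}" "(a, b) \<in> E" for a b w
        using leg_arcs_cover[of u "l w" a b] l[OF that(2)] that by (auto simp: spider_def)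
      have conv: "(b, a) \<in> parcs (spider u (l ` (E `` {u})))"
        if "(a, b) \<in> parcs (spider u (l ` (E `` {u})))" for a b
        using that unfolding spider_def by auto
      show "E \<subseteq> parcs (spider u (l ` (E `` {u})))"
      proof
        fix e assume e: "e \<in> E"
        obtain a b where ab: "e = (a, b)" by (cases e)
        have mem: "a \<in> V" "b \<in> V" using e ab arc_V by auto
        consider "a = u" | w where "w \<in> E `` {u}" "a \<in> set (l w)"
          using mem V unfolding spider_def by auto
        then show "e \<in> parcs (spider u (l ` (E `` {u})))"
        proof cases
          case 1
          then have b: "b \<in> E `` {u}" using e ab by auto
          \<comment> \<open>\<open>leg_arcs_cover\<close> treats arcs that start on a leg; an arc
            leaving the centre is therefore read backwards.\<close>
          have "b \<in> set (l b)" using l[OF b] leg_nonempty hd_in_set by metis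
          then show ?thesis using in_leg[of b b a] b conv arc_sym e ab by blast
        next
          case 2
          then show ?thesis using in_leg e ab by blast
        qed
      qed
    qed
  qed
qed

section \<open>A degree invariant of subdivided stars\<close>

text \<open>Subdivision preserves the degrees of old vertices and adds a vertex of degree 2, so only
  the centre can have degree above 2. Containment in \<open>{a, b}\<close> expresses degree at most
  2 without cardinalities.\<close>

lemma subdivided_star_thin:
  assumes "subdivided_star G"
  shows "\<exists>c. \<forall>x. x \<noteq> c \<longrightarrow> (\<exists>a b. parcs G `` {x} \<subseteq> {a, b})"
proof -
  define P where "P = (\<lambda>G :: 'a pair_pre_digraph. parcs G \<subseteq> pverts G \<times> pverts G \<and> sym (parcs G) \<and>
    (\<exists>c. \<forall>x. x \<noteq> c \<longrightarrow> (\<exists>a b. parcs G `` {x} \<subseteq> {a, b})))"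
  have step: "P H" if PG: "P G" and sub: "edge_subdivision G H" for G H
  proof -
    obtain u v w where uv: "(u, v) \<in> parcs G" "w \<notin> pverts G" "H = subdivide G (u, v) w"
      using sub unfolding edge_subdivision_def by blast
    have wf: "parcs G \<subseteq> pverts G \<times> pverts G" "sym (parcs G)" using PG P_def by auto
    obtain c where c: "\<And>x. x \<noteq> c \<Longrightarrow> \<exists>a b. parcs G `` {x} \<subseteq> {a, b}"
      using PG P_def by blast
    have vu: "(v, u) \<in> parcs G" using uv wf by (auto dest: symD)
    have "\<exists>a b. parcs H `` {x} \<subseteq> {a, b}" if "x \<noteq> c" for x
    proof (cases "x = w")
      case True
      have "parcs H `` {x} \<subseteq> {u, v}" using uv wf True by auto
      then show ?thesis by blast
    next
      case False
      obtain a b where ab: "parcs G `` {x} \<subseteq> {a, b}" using c \<open>x \<noteq> c\<close> by blast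
      \<comment> \<open>At an end of the subdivided edge, \<open>w\<close> takes the slot of the
        other end; the cases tell which of the two slots that is.\<close>
      consider "x = u" "v = a" | "x = u" "v = b" | "x = v" "u = a" | "x = v" "u = b"
        | "x \<noteq> u" "x \<noteq> v" using ab uv(1) vu by auto
      then show ?thesis
      proof cases
        case 1
        then have "parcs H `` {x} \<subseteq> {w, b}" using ab uv False by auto
        then show ?thesis by blast
      next
        case 2
        then have "parcs H `` {x} \<subseteq> {w, a}" using ab uv False by auto
        then show ?thesis by blast
      next
        case 3
        then have "parcs H `` {x} \<subseteq> {w, b}" using ab uv False by auto
        then show ?thesis by blast
      next
        case 4
        then have "parcs H `` {x} \<subseteq> {w, a}" using ab uv False by auto
        then show ?thesis by blast
      next
        case 5
        then have "parcs H `` {x} \<subseteq> {a, b}" using ab uv False by auto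
        then show ?thesis by blast
      qed
    qed
    moreover have "parcs H \<subseteq> pverts H \<times> pverts H"
      using wf uv vu by auto
    moreover have "sym (parcs H)"
      using wf(2) uv(3) by (auto simp: sym_def)
    ultimately show "P H" unfolding P_def by blast
  qed
  obtain S m where S: "complete_bipartite_digraph 1 m (with_proj S)" "edge_subdivision\<^sup>+\<^sup>+ S G"
    using assms unfolding subdivided_star_def by blast
  have "P S"
  proof -
    obtain U W where UW: "pverts S = U \<union> W" "U \<inter> W = {}" "card U = 1" "parcs S = U \<times> W \<union> W \<times> U"
      using S(1) unfolding complete_bipartite_digraph_pair_def by blast
    then obtain c where "U = {c}" by (meson card_1_singletonE)
    then have "parcs S `` {x} \<subseteq> {c, c}" if "x \<noteq> c" for x using UW that by auto
    then have "\<exists>c. \<forall>x. x \<noteq> c \<longrightarrow> (\<exists>a b. parcs S `` {x} \<subseteq> {a, b})" by blast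
    moreover have "parcs S \<subseteq> pverts S \<times> pverts S" "sym (parcs S)"
      unfolding UW by (auto simp: sym_def)
    ultimately show ?thesis unfolding P_def by blast
  qed
  with S(2) have "P G" by (induction rule: tranclp_induct) (auto intro: step)
  then show ?thesis unfolding P_def by blast
qed

section \<open>Pair graphs\<close>

lemma pcas_append: "pcas u (p @ q) w \<longleftrightarrow> (\<exists>v. pcas u p v \<and> pcas v q w)"
  by (induction p arbitrary: u) auto

lemma pawalk_verts_snoc: "pcas u p (fst e) \<Longrightarrow> pawalk_verts u (p @ [e]) = pawalk_verts u p @ [snd e]"
  by (induction p arbitrary: u) auto

lemma pcas_nth_Suc: "pcas u p v \<Longrightarrow> Suc i < length p \<Longrightarrow> fst (p ! Suc i) = snd (p ! i)"
proof (induction p arbitrary: u i)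
  case (Cons e es)
  then show ?case by (cases i; cases es) auto
qed simp

lemma pcas_ends:
  "pcas u p v \<Longrightarrow> p \<noteq> [] \<Longrightarrow> fst (p ! 0) = u \<and> snd (p ! (length p - 1)) = v"
proof (induction p arbitrary: u)
  case (Cons e es)
  then show ?case by (cases es) auto
qed simp

lemma pawalk_verts_eq: "pcas u p v \<Longrightarrow> pawalk_verts u p = u # map snd p"
  by (induction p arbitrary: u) auto

text \<open>On a cycle each vertex has its predecessor and its successor as neighbours. This reduces
  acyclicity of \<open>T9\<close> to an extremal argument.\<close>

lemma long_cycle_two_neighbours:
  assumes "pair_graph G" "pre_digraph.cycle (with_proj G) p" "length p \<ge> 3"
  shows "\<exists>W. W \<noteq> {} \<and> finite W \<and>
    (\<forall>x\<in>W. \<exists>a\<in>W. \<exists>b\<in>W. a \<noteq> b \<and> (x, a) \<in> parcs G \<and> (x, b) \<in> parcs G)"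
proof -
  interpret pair_graph G by (rule assms(1))
  obtain u where u: "set p \<subseteq> parcs G" "pcas u p u" "distinct (tl (pawalk_verts u p))"
    using assms(2) unfolding cycle_def awalk_def by auto
  have dist: "distinct (map snd p)" using u(3) pawalk_verts_eq[OF u(2)] by simp
  let ?k = "length p"
  define n where "n = (\<lambda>i. if Suc i = ?k then 0 else Suc i)"
  have n_less: "n i < ?k" if "i < ?k" for i using that by (auto simp: n_def)
  have fst_n: "fst (p ! n i) = snd (p ! i)" if "i < ?k" for i
  proof (cases "Suc i = ?k")
    case True
    then have "?k - 1 = i" "p \<noteq> []" by auto
    then show ?thesis using True pcas_ends[OF u(2)] by (simp add: n_def)
  next
    case False
    then show ?thesis using that pcas_nth_Suc[OF u(2), of i] by (simp add: n_def)
  qed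
  have arc: "(snd (p ! i), snd (p ! n i)) \<in> parcs G" if "i < ?k" for i
    using fst_n[OF that] n_less[OF that] u(1) nth_mem[of "n i" p] by (metis prod.collapse subsetD)
  have n_surj: "\<exists>j<?k. n j = i" if "i < ?k" for i
  proof (cases i)
    case 0
    then show ?thesis using assms(3) by (intro exI[of _ "?k - 1"]) (auto simp: n_def)
  next
    case (Suc j)
    then show ?thesis using that by (intro exI[of _ j]) (auto simp: n_def)
  qed
  show ?thesis
  proof (intro exI[of _ "snd ` set p"] conjI ballI)
    fix x assume "x \<in> snd ` set p"
    then obtain i where i: "i < ?k" "x = snd (p ! i)" by (auto simp: in_set_conv_nth)
    obtain j where j: "j < ?k" "n j = i" using n_surj i by blast
    \<comment> \<open>Successor and predecessor agree only on cycles of length at most 2, such as an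
      edge traversed back and forth.\<close>
    have "n i \<noteq> j" using assms(3) i j by (auto simp: n_def split: if_splits)
    then have "snd (p ! n i) \<noteq> snd (p ! j)"
      using dist n_less[OF i(1)] j by (metis length_map nth_eq_iff_index_eq nth_map)
    moreover have "(x, snd (p ! n i)) \<in> parcs G" using arc i by simp
    moreover have "(x, snd (p ! j)) \<in> parcs G" using arc[OF j(1)] i j arcs_symmetric by simp
    moreover have "snd (p ! n i) \<in> snd ` set p" "snd (p ! j) \<in> snd ` set p"
      using n_less[OF i(1)] j by simp_all
    ultimately show "\<exists>a\<in>snd ` set p. \<exists>b\<in>snd ` set p. a \<noteq> b \<and> (x, a) \<in> parcs G \<and> (x, b) \<in> parcs G"
      by blast
  qed (use assms(3) in auto)
qed

text \<open>If \<open>z\<close> were in the branch of \<open>y\<close>, a simple path from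
  \<open>y\<close> to \<open>z\<close> avoiding \<open>x\<close> would close up through
  \<open>x\<close> to a long cycle.\<close>

lemma undirected_tree_rel:
  assumes "undirected_tree G"
  shows "tree_rel (pverts G) (parcs G)"
proof -
  interpret pair_graph G using assms undirected_tree_def by blast
  have symE: "sym (parcs G)" using arcs_symmetric by (auto intro: symI)
  show ?thesis
  proof
    show "finite (pverts G)" by (rule pair_finite_verts)
    show "parcs G \<subseteq> pverts G \<times> pverts G" using wellformed' by auto
    show "sym (parcs G)" by (rule symE)
    show "(x, x) \<notin> parcs G" for x using pair_no_loops by force
    show "(x, y) \<in> (parcs G)\<^sup>*" if "x \<in> pverts G" "y \<in> pverts G" for x y
    proof -
      have "Digraph_Component.connected (with_proj G)" using assms undirected_tree_def by blast
      then have "strongly_connected (with_proj G)"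
        using symmetric_connected_imp_strongly_connected sym_arcs by blast
      then have "x \<rightarrow>\<^sup>*\<^bsub>with_proj G\<^esub> y" using that by (auto simp: strongly_connected_def)
      then show ?thesis using reachable_rtranclI by fastforce
    qed
    fix x y z assume xyz: "(x, y) \<in> parcs G" "(x, z) \<in> parcs G" "y \<noteq> z"
    show "z \<notin> branch (parcs G) x y"
    proof
      assume z: "z \<in> branch (parcs G) x y"
      \<comment> \<open>Paths in the graph without \<open>x\<close> avoid \<open>x\<close>
        automatically, and reachability there yields a simple one.\<close>
      define H where "H = \<lparr> pverts = pverts G - {x}, parcs = parcs G \<inter> (- {x}) \<times> (- {x}) \<rparr>"
      interpret H: pair_wf_digraph H
        by unfold_locales (auto simp: H_def intro: wellformed')
      have "y \<in> pverts H" using in_arcsD2[OF xyz(1)] no_loops'[OF xyz(1)] by (auto simp: H_def)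
      then have "y \<rightarrow>\<^sup>*\<^bsub>with_proj H\<^esub> z"
        using z H.reachable_conv'[of y z] by (simp add: branch_def H_def)
      then obtain q where q: "H.apath y q z" using H.reachable_apath by blast
      then have q': "set q \<subseteq> parcs H" "pcas y q z" "distinct (pawalk_verts y q)"
        unfolding H.apath_def H.awalk_def by blast+
      let ?p = "(x, y) # q @ [(z, x)]"
      have "x \<notin> set (pawalk_verts y q)" 
        using q'(1) no_loops'[OF xyz(1)] unfolding pawalk_verts_eq[OF q'(2)] H_def by auto
      moreover have "pawalk_verts x ?p = x # pawalk_verts y q @ [x]"
        using pawalk_verts_snoc[of y q "(z, x)"] q'(2) by simp
      moreover have "awalk x ?p x"
      proof -
        have "set ?p \<subseteq> parcs G"
          using q'(1) xyz(1) arcs_symmetric[OF xyz(2)] by (auto simp: H_def)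
        moreover have "pcas x ?p x" 
          unfolding pcas.simps pcas_append fst_conv snd_conv using q'(2) by blast
        ultimately show ?thesis unfolding awalk_def using in_arcsD1[OF xyz(1)] by blast
      qed
      ultimately have "cycle ?p" unfolding cycle_def using q'(3) by (intro exI[of _ x]) auto
      \<comment> \<open>Since \<open>y \<noteq> z\<close>, the path \<open>q\<close> has at least
        one arc besides the two arcs at \<open>x\<close>.\<close>
      moreover have "length ?p \<ge> 3" using xyz(3) q'(2) by (cases q) auto
      ultimately show False using assms undirected_tree_def by blast
    qed
  qed
qed

lemma pair_isomorphism:
  assumes "pair_wf_digraph G" "bij_betw f (pverts G) (pverts H)"
    and "map_prod f f ` parcs G = parcs H"
  shows "\<exists>h. pre_digraph.digraph_isomorphism (with_proj G) h \<and> app_iso h (with_proj G) = with_proj H \<and>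
    iso_verts h = f"
proof -
  interpret pair_wf_digraph G by (rule assms(1))
  let ?h = "\<lparr> iso_verts = f, iso_arcs = map_prod f f, iso_head = snd, iso_tail = fst \<rparr>"
  have "inj_on (map_prod f f) (pverts G \<times> pverts G)"
    using assms(2) by (intro map_prod_inj_on) (auto simp: bij_betw_def)
  moreover have "parcs G \<subseteq> pverts G \<times> pverts G" using wellformed' by auto
  ultimately have "inj_on (map_prod f f) (parcs G)" by (rule inj_on_subset)
  moreover have "wf_digraph (with_proj G)" by unfold_locales
  ultimately have "digraph_isomorphism ?h"
    using assms(2) unfolding digraph_isomorphism_def by (auto simp: bij_betw_def)
  moreover have "app_iso ?h (with_proj G) = with_proj H"
    using assms(2,3) by (simp add: app_iso_def with_proj_def bij_betw_def)
  ultimately show ?thesis by force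
qed

lemma asymmetric_graph_iff_rigid:
  assumes "pair_wf_digraph G"
  shows "asymmetric_graph G \<longleftrightarrow> rigid (pverts G) (parcs G)"
proof
  assume "asymmetric_graph G"
  then show "rigid (pverts G) (parcs G)"
    unfolding asymmetric_graph_def rigid_def using pair_isomorphism[OF assms] by metis
next
  assume r: "rigid (pverts G) (parcs G)"
  interpret pair_wf_digraph G by (rule assms)
  show "asymmetric_graph G"
    unfolding asymmetric_graph_def
  proof (intro allI impI)
    fix h :: "('a, 'a \<times> 'a, 'a, 'a \<times> 'a) digraph_isomorphism"
    assume "digraph_isomorphism h \<and> app_iso h (with_proj G) = with_proj G"
    then have h: "digraph_isomorphism h" "app_iso h (with_proj G) = with_proj G" by auto
    from h(2) have h': "iso_verts h ` pverts G = pverts G" "iso_arcs h ` parcs G = parcs G"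
      "iso_tail h = fst" "iso_head h = snd"
      by (simp_all add: app_iso_def with_proj_def)
    \<comment> \<open>The arc map is a separate component of \<open>h\<close>, but tail and head
      remain the projections, so it is determined by the vertex map.\<close>
    have "map_prod (iso_verts h) (iso_verts h) e = iso_arcs h e" if "e \<in> parcs G" for e
      using h(1) that unfolding digraph_isomorphism_def h'
      by (cases e) (auto simp: prod_eq_iff)
    then have "map_prod (iso_verts h) (iso_verts h) ` parcs G = parcs G"
      using h'(2) by (metis image_cong)
    moreover have "bij_betw (iso_verts h) (pverts G) (pverts G)"
      using h(1) h'(1) unfolding digraph_isomorphism_def bij_betw_def by simp
    ultimately show "\<forall>v\<in>pverts G. iso_verts h v = v" using r unfolding rigid_def by blast
  qed
qed

section \<open>The tree \<open>T9\<close>\<close>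

context
  notes One_nat_def [simp del]
begin

lemma T9_verts: "pverts T9 = {1, 2, 3, 4, 5, 6, 7, 8, 9}"
proof -
  have "{1..9::nat} = {1, 2, 3, 4, 5, 6, 7, 8, 9}" by (rule set_eqI, simp, presburger)
  then show ?thesis by (simp add: T9_def Let_def)
qed

lemma converse_insert_pair: "(insert (a, b) R)\<inverse> = insert (b, a) (R\<inverse>)"
  by auto

lemma Image_insert_pair:
  "insert (a, b) R `` {x} = (if a = x then insert b (R `` {x}) else R `` {x})"
  by auto

lemma T9_arcs: "parcs T9 = {(1,2), (2,3), (3,4), (2,5), (1,6), (1,7), (7,8), (8,9),
    (2,1), (3,2), (4,3), (5,2), (6,1), (7,1), (8,7), (9,8)}"
  unfolding T9_def Let_def pair_pre_digraph.simps converse_insert_pair converse_empty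
    Un_insert_left Un_empty_left ..

lemma T9_neighbours:
  "parcs T9 `` {1} = {2, 6, 7}" "parcs T9 `` {2} = {3, 5, 1}" "parcs T9 `` {3} = {4, 2}"
  "parcs T9 `` {4} = {3}" "parcs T9 `` {5} = {2}" "parcs T9 `` {6} = {1}"
  "parcs T9 `` {7} = {8, 1}" "parcs T9 `` {8} = {9, 7}" "parcs T9 `` {9} = {8}"
  by (simp_all only: T9_arcs Image_insert_pair Image_empty1) simp_all

lemma pair_graph_T9: "pair_graph T9"
proof -
  have wf: "parcs T9 \<subseteq> pverts T9 \<times> pverts T9"
    unfolding T9_verts T9_arcs by simp
  have irrefl: "\<forall>e\<in>parcs T9. fst e \<noteq> snd e"
    unfolding T9_arcs by simp
  have "sym (parcs T9)"
    unfolding T9_def Let_def pair_pre_digraph.simps by (rule sym_Un_converse)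
  moreover have "finite (parcs T9)" "finite (pverts T9)"
    unfolding T9_verts T9_arcs by simp_all
  ultimately show ?thesis
    using wf irrefl by unfold_locales (auto simp: symmetric_def)
qed

lemma undirected_tree_T9: "undirected_tree T9"
  unfolding undirected_tree_def
proof (intro conjI)
  interpret pair_graph T9 by (rule pair_graph_T9)
  show "pair_graph T9" by (rule pair_graph_T9)
  have root: "x \<rightarrow>\<^sup>*\<^bsub>with_proj T9\<^esub> 1" if "x \<in> pverts T9" for x
  proof -
    have r1: "1 \<rightarrow>\<^sup>*\<^bsub>with_proj T9\<^esub> 1" by (simp add: T9_verts)
    note step = adj_reachable_trans[unfolded with_proj_simps]
    have r2: "2 \<rightarrow>\<^sup>*\<^bsub>with_proj T9\<^esub> 1" by (rule step[OF _ r1]) (simp add: T9_arcs)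
    have r3: "3 \<rightarrow>\<^sup>*\<^bsub>with_proj T9\<^esub> 1" by (rule step[OF _ r2]) (simp add: T9_arcs)
    have r4: "4 \<rightarrow>\<^sup>*\<^bsub>with_proj T9\<^esub> 1" by (rule step[OF _ r3]) (simp add: T9_arcs)
    have r5: "5 \<rightarrow>\<^sup>*\<^bsub>with_proj T9\<^esub> 1" by (rule step[OF _ r2]) (simp add: T9_arcs)
    have r6: "6 \<rightarrow>\<^sup>*\<^bsub>with_proj T9\<^esub> 1" by (rule step[OF _ r1]) (simp add: T9_arcs)
    have r7: "7 \<rightarrow>\<^sup>*\<^bsub>with_proj T9\<^esub> 1" by (rule step[OF _ r1]) (simp add: T9_arcs)
    have r8: "8 \<rightarrow>\<^sup>*\<^bsub>with_proj T9\<^esub> 1" by (rule step[OF _ r7]) (simp add: T9_arcs)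
    have r9: "9 \<rightarrow>\<^sup>*\<^bsub>with_proj T9\<^esub> 1" by (rule step[OF _ r8]) (simp add: T9_arcs)
    have "\<forall>x\<in>pverts T9. x \<rightarrow>\<^sup>*\<^bsub>with_proj T9\<^esub> 1"
      unfolding T9_verts by (intro ballI, elim insertE emptyE) (simp_all only: r1 r2 r3 r4 r5 r6 r7 r8 r9)
    then show ?thesis using that by (rule bspec)
  qed
  show "Digraph_Component.connected (with_proj T9)"
  proof (rule connectedI)
    fix x y assume "x \<in> pverts T9" "y \<in> pverts T9"
    then have "x \<rightarrow>\<^sup>*\<^bsub>with_proj T9\<^esub> y"
      using root symmetric_reachable' reachable_trans by blast
    then show "x \<rightarrow>\<^sup>*\<^bsub>with_proj (mk_symmetric (with_proj T9))\<^esub> y"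
      by (rule reachable_mk_symmetricI)
  next
    show "pverts T9 \<noteq> {}" unfolding T9_verts by (rule insert_not_empty)
  qed
  show "\<not> (\<exists>p. cycle p \<and> length p \<ge> 3)"
  proof
    assume "\<exists>p. cycle p \<and> length p \<ge> 3"
    then obtain p where p: "cycle p" "length p \<ge> 3" by (elim exE conjE)
    obtain W where W: "W \<noteq> {}" "finite W"
      "\<forall>x\<in>W. \<exists>a\<in>W. \<exists>b\<in>W. a \<noteq> b \<and> (x, a) \<in> parcs T9 \<and> (x, b) \<in> parcs T9"
      using long_cycle_two_neighbours[OF pair_graph_T9 p] by (elim exE conjE)
    \<comment> \<open>Extremal choice: the largest label in \<open>W\<close> has two distinct
      neighbours in \<open>W\<close>, neither exceeding it.\<close>
    from bspec[OF W(3) Max_in[OF W(2,1)]] obtain a b where ab: "a \<in> W" "b \<in> W" "a \<noteq> b"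
      "(Max W, a) \<in> parcs T9" "(Max W, b) \<in> parcs T9"
      by (elim bexE conjE)
    then have "a \<le> Max W" "b \<le> Max W" using W(2) by simp_all
    \<comment> \<open>in the labelling of \<open>T9\<close> every vertex has at most one smaller neighbour\<close>
    moreover have "\<forall>x\<in>pverts T9. \<forall>a\<in>parcs T9 `` {x}. \<forall>b\<in>parcs T9 `` {x}. a \<le> x \<and> b \<le> x \<longrightarrow> a = b"
      unfolding T9_verts by (simp add: T9_neighbours)
    moreover have "Max W \<in> pverts T9" using ab(4) by (rule wellformed')
    ultimately show False using ab(3-5) by blast
  qed
qed

lemma automorphism_neighbours:
  assumes "bij_betw f V V" "map_prod f f ` E = E" "E \<subseteq> V \<times> V" "x \<in> V"
  shows "E `` {f x} = f ` (E `` {x})" "card (E `` {f x}) = card (E `` {x})"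
proof -
  have inj: "inj_on f V" using assms(1) by (simp add: bij_betw_def)
  show eq: "E `` {f x} = f ` (E `` {x})"
  proof
    show "f ` (E `` {x}) \<subseteq> E `` {f x}"
    proof
      fix y assume "y \<in> f ` (E `` {x})"
      then obtain z where z: "(x, z) \<in> E" "y = f z" by auto
      then have "map_prod f f (x, z) \<in> E" using assms(2) by blast
      then show "y \<in> E `` {f x}" using z by simp
    qed
    show "E `` {f x} \<subseteq> f ` (E `` {x})"
    proof
      fix y assume "y \<in> E `` {f x}"
      then have "(f x, y) \<in> map_prod f f ` E" using assms(2) by simp
      then obtain a b where ab: "(a, b) \<in> E" "f a = f x" "y = f b" by auto
      then have "a = x" using inj assms(3,4) by (auto dest: inj_onD)
      then show "y \<in> f ` (E `` {x})" using ab by auto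
    qed
  qed
  have "inj_on f (E `` {x})" using inj assms(3) by (auto intro: inj_on_subset)
  then show "card (E `` {f x}) = card (E `` {x})" unfolding eq by (rule card_image)
qed

lemma rigid_T9: "rigid (pverts T9) (parcs T9)"
  unfolding rigid_def
proof (intro allI impI)
  let ?E = "parcs T9"
  fix f assume f: "bij_betw f (pverts T9) (pverts T9) \<and> map_prod f f ` ?E = ?E"
  have wf: "?E \<subseteq> pverts T9 \<times> pverts T9" unfolding T9_arcs T9_verts by simp
  note nb = automorphism_neighbours[OF conjunct1[OF f] conjunct2[OF f] wf]
  have deg: "card (?E `` {f x}) = card (?E `` {x})" if "x \<in> pverts T9" for x
    using nb(2) that .
  have adj: "f y \<in> ?E `` {f x}" if "x \<in> pverts T9" "y \<in> ?E `` {x}" for x y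
    using nb(1)[OF that(1)] that(2) by blast
  have fV: "f x \<in> pverts T9" if "x \<in> pverts T9" for x
    using f that by (auto simp: bij_betw_def)
  have "\<forall>y\<in>pverts T9. card (?E `` {y}) = 1 \<longrightarrow> y \<in> {4, 5, 6, 9}"
    unfolding T9_verts by (simp add: T9_neighbours)
  then have deg1: "y \<in> {4, 5, 6, 9}" if "y \<in> pverts T9" "card (?E `` {y}) = 1" for y
    using that by blast
  have "\<forall>y\<in>pverts T9. card (?E `` {y}) = 2 \<longrightarrow> y \<in> {3, 7, 8}"
    unfolding T9_verts by (simp add: T9_neighbours)
  then have deg2: "y \<in> {3, 7, 8}" if "y \<in> pverts T9" "card (?E `` {y}) = 2" for y
    using that by blast
  have "\<forall>y\<in>pverts T9. card (?E `` {y}) = 3 \<longrightarrow> y \<in> {1, 2}"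
    unfolding T9_verts by (simp add: T9_neighbours)
  then have deg3: "y \<in> {1, 2}" if "y \<in> pverts T9" "card (?E `` {y}) = 3" for y
    using that by blast
  have f12: "f 1 \<in> {1, 2}" "f 2 \<in> {1, 2}"
    by (rule deg3[OF fV]; simp add: deg T9_verts T9_neighbours)+
  have f378: "f 3 \<in> {3, 7, 8}" "f 7 \<in> {3, 7, 8}" "f 8 \<in> {3, 7, 8}"
    by (rule deg2[OF fV]; simp add: deg T9_verts T9_neighbours)+
  have f4569: "f 4 \<in> {4, 5, 6, 9}" "f 5 \<in> {4, 5, 6, 9}" "f 6 \<in> {4, 5, 6, 9}" "f 9 \<in> {4, 5, 6, 9}"
    by (rule deg1[OF fV]; simp add: deg T9_verts T9_neighbours)+
  have adjs: "f 8 \<in> ?E `` {f 7}" "f 7 \<in> ?E `` {f 1}" "f 6 \<in> ?E `` {f 1}" "f 9 \<in> ?E `` {f 8}"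
    "f 2 \<in> ?E `` {f 1}" "f 3 \<in> ?E `` {f 2}" "f 5 \<in> ?E `` {f 2}" "f 4 \<in> ?E `` {f 3}"
    by (rule adj; simp add: T9_verts T9_neighbours)+
  \<comment> \<open>The vertex 1 starts a path 7, 8 of vertices of degree 2, whereas 3, the only
    neighbour of 2 of degree 2, has no neighbour of degree 2.\<close>
  have "f 1 \<noteq> 2"
  proof
    assume 1: "f 1 = 2"
    then have 7: "f 7 = 3" using adjs(2) f378(2) by (auto simp: T9_neighbours)
    show False using adjs(1) f378(3) unfolding 7 T9_neighbours by auto
  qed
  then have 1: "f 1 = 1" using f12 by auto
  \<comment> \<open>From here on, the degree class and the neighbourhood of a fixed vertex have
    exactly one vertex in common.\<close>
  have 7: "f 7 = 7" using adjs(2) f378(2) unfolding 1 T9_neighbours by auto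
  have 6: "f 6 = 6" using adjs(3) f4569(3) unfolding 1 T9_neighbours by auto
  have 2: "f 2 = 2" using adjs(5) f12(2) unfolding 1 T9_neighbours by auto
  have 8: "f 8 = 8" using adjs(1) f378(3) unfolding 7 T9_neighbours by auto
  have 9: "f 9 = 9" using adjs(4) f4569(4) unfolding 8 T9_neighbours by auto
  have 3: "f 3 = 3" using adjs(6) f378(1) unfolding 2 T9_neighbours by auto
  have 5: "f 5 = 5" using adjs(7) f4569(2) unfolding 2 T9_neighbours by auto
  have 4: "f 4 = 4" using adjs(8) f4569(1) unfolding 3 T9_neighbours by auto
  show "\<forall>v\<in>pverts T9. f v = v" unfolding T9_verts using 1 2 3 4 5 6 7 8 9 by simp
qed

text \<open>Both 1 and 2 have three neighbours, and only one of them can be the exceptional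
  vertex.\<close>

lemma not_subdivided_star_T9: "\<not> subdivided_star T9"
proof
  assume "subdivided_star T9"
  then obtain c where c: "\<And>x. x \<noteq> c \<Longrightarrow> \<exists>a b. parcs T9 `` {x} \<subseteq> {a, b}"
    using subdivided_star_thin by blast
  show False
  proof (cases "c = 1")
    case True
    then obtain a b where "{3, 5, 1 :: nat} \<subseteq> {a, b}" using c[of 2] by (auto simp: T9_neighbours)
    then show False by auto
  next
    case False
    then obtain a b where "{2, 6, 7 :: nat} \<subseteq> {a, b}" using c[of 1] by (auto simp: T9_neighbours)
    then show False by auto
  qed
qed

lemma isomorphic_T9:
  fixes G :: "'a pair_pre_digraph"
  assumes "pair_wf_digraph G" "distinct [u, a, b, b', v, c, d, d', d'']"
    and V: "pverts G = {u, a, b, b', v, c, d, d', d''}"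
    and N: "parcs G `` {u} = {v, a, b}" "parcs G `` {a} = {u}" "parcs G `` {b} = {u, b'}"
      "parcs G `` {b'} = {b}" "parcs G `` {v} = {u, c, d}" "parcs G `` {c} = {v}"
      "parcs G `` {d} = {v, d'}" "parcs G `` {d'} = {d, d''}" "parcs G `` {d''} = {d'}"
  shows "digraph_iso (with_proj G) (with_proj T9)"
proof -
  interpret pair_wf_digraph G by (rule assms(1))
  \<comment> \<open>\<open>u\<close> with legs 1, 2 corresponds to vertex 2, and \<open>v\<close>
    with legs 1, 3 to vertex 1. The default 0 is taken outside \<open>pverts G\<close> only.\<close>
  define f :: "'a \<Rightarrow> nat" where
    "f = (\<lambda>_. 0)(u := 2, a := 5, b := 3, b' := 4, v := 1, c := 6, d := 7, d' := 8, d'' := 9)"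
  have f: "f u = 2" "f a = 5" "f b = 3" "f b' = 4" "f v = 1" "f c = 6" "f d = 7" "f d' = 8" "f d'' = 9"
    using assms(2) by (simp_all add: f_def)
  have "parcs G = (\<Union>x\<in>pverts G. {x} \<times> parcs G `` {x})" using wellformed' by auto
  also have "\<dots> = {(u, v), (u, a), (u, b), (a, u), (b, u), (b, b'), (b', b), (v, u), (v, c), (v, d),
      (c, v), (d, v), (d, d'), (d', d), (d', d''), (d'', d')}"
    unfolding V by (simp add: N insert_commute)
  finally have "map_prod f f ` parcs G = parcs T9"
    unfolding T9_arcs by (simp add: f insert_commute)
  moreover have "bij_betw f (pverts G) (pverts T9)"
  proof (rule bij_betw_imageI)
    show "inj_on f (pverts G)" unfolding V inj_on_def by (simp add: f)
    show "f ` pverts G = pverts T9" unfolding V T9_verts by (simp add: f insert_commute)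
  qed
  ultimately show ?thesis
    using pair_isomorphism[OF assms(1)] unfolding digraph_iso_def by metis
qed

end

section \<open>Classification up to nine vertices\<close>

lemma small_asymmetric_tree:
  fixes G :: "'a pair_pre_digraph"
  assumes tree: "undirected_tree G" and asym: "asymmetric_graph G"
    and card: "card (pverts G) \<ge> 2" "card (pverts G) \<le> 9" and star: "\<not> subdivided_star G"
  shows "digraph_iso (with_proj G) (with_proj T9)"
proof -
  interpret tree_rel "pverts G" "parcs G" by (rule undirected_tree_rel[OF tree])
  have wf: "pair_wf_digraph G"
    using tree unfolding undirected_tree_def pair_graph_def pair_digraph_def pair_fin_digraph_def by blast
  then have rigid: "rigid (pverts G) (parcs G)" using asym asymmetric_graph_iff_rigid by blast
  obtain r where r: "r \<in> pverts G" using card by fastforce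
  have "\<exists>w\<in>parcs G `` {u}. \<nexists>ws. leg u (w # ws)" if u: "u \<in> pverts G" for u
  proof (rule ccontr)
    assume no: "\<not> ?thesis"
    \<comment> \<open>A second vertex excludes an isolated \<open>u\<close>, which would give a
      spider without legs.\<close>
    have "parcs G `` {u} \<noteq> {}"
      using vertices_decomp[OF u] card(1) by force
    then obtain L where L: "spider_legs u L" "pverts G = pverts (spider u L)" "parcs G = parcs (spider u L)"
      using all_legs_spider[OF u] no by blast
    have "G = spider u L" using L by (intro pair_pre_digraph.equality) auto
    then show False using rigid_spider_subdivided_star[OF L(1)] rigid star by simp
  qed
  from two_forks[OF r this] obtain u p v q where
    forks: "fork u p" "fork v q" "v \<in> branch (parcs G) u p" "u \<in> branch (parcs G) v q" by blast
  let ?B = "\<lambda>u p. \<Union>w\<in>parcs G `` {u} - {p}. branch (parcs G) u w"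
  \<comment> \<open>The roles of the two forks are symmetric, so either may be the smaller
    end.\<close>
  consider "card (?B u p) \<le> card (?B v q)" | "card (?B v q) \<le> card (?B u p)" by linarith
  then show ?thesis
  proof cases
    case 1
    from small_two_forks[OF rigid card(2) forks 1] show ?thesis
      using isomorphic_T9[OF wf] by (elim exE conjE) blast
  next
    case 2
    from small_two_forks[OF rigid card(2) forks(2,1) forks(4,3) 2] show ?thesis
      using isomorphic_T9[OF wf] by (elim exE conjE) blast
  qed
qed

theorem mainTheorem2:
  shows "undirected_tree T9 \<and> asymmetric_graph T9 \<and> \<not> subdivided_star T9 \<and>
    (\<forall>G :: 'a pair_pre_digraph.
       undirected_tree G \<and> asymmetric_graph G \<and> card (pverts G) \<ge> 2 \<and>
       \<not> subdivided_star G \<and> \<not> digraph_iso (with_proj G) (with_proj T9)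
       \<longrightarrow> card (pverts G) > 9)"
proof (intro conjI allI impI)
  interpret pair_graph T9 by (rule pair_graph_T9)
  have "pair_wf_digraph T9" by unfold_locales
  then show "asymmetric_graph T9" using asymmetric_graph_iff_rigid rigid_T9 by blast
next
  fix G :: "'a pair_pre_digraph"
  assume "undirected_tree G \<and> asymmetric_graph G \<and> card (pverts G) \<ge> 2 \<and>
    \<not> subdivided_star G \<and> \<not> digraph_iso (with_proj G) (with_proj T9)"
  then show "card (pverts G) > 9"
    using small_asymmetric_tree[of G] by (meson not_less)
qed (rule undirected_tree_T9 not_subdivided_star_T9)+

end
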